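(* Let $N$ be a compact smooth manifold of dimension $3$, let $u:N\times(0,\infty)\to\mathbb{R}$ be a smooth function, and let $h(t)$, $t\in(0,\infty)$, be a smooth family of Riemannian metrics on $N$. Write $u(t)=u(\cdot,t)$, and let $M=N\times_u\mathbb{R}$ be the $4$-dimensional warped product, that is, the manifold $N\times\mathbb{R}$ equipped with the family of metrics $$g(t)=h(t)+e^{2u(t)}\,ds^2,\qquad t\in(0,\infty),$$ where $s$ is the standard coordinate on $\mathbb{R}$. Assume that $(M,g(t))$, $0<t<\infty$, has positive scalar curvature and is a type III solution to the Ricci flow, i.e. $\partial_t g(t)=-2\,Rc(g(t))$ for all $t\in(0,\infty)$ and $$\sup_{M\times(0,\infty)} t\,|Rm|(g(t))<\infty.$$ Let $\alpha>0$. Then there is a uniform constant $C>0$ such that $$t\left[\,|Rm(h(t))|+|D^2u(t)|^2+|\nabla u(t)|^2\,\right]\le C\qquad\text{on } N \text{ for all } t>\alpha.$$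
   Context: $Rc(g)$ denotes the Ricci curvature tensor and $Rm(g)$ (also $|Rm|(g)$ for its norm) the Riemann curvature tensor of a Riemannian metric $g$. In the conclusion, $\nabla u(t)$ and $D^2u(t)$ are the gradient and Hessian of $u(t)$ on $N$ with respect to $h(t)$, and all norms there are taken with respect to $h(t)$; the norm of $Rm(g(t))$ is taken with respect to $g(t)$. "Uniform constant" means that $C$ is independent of the point of $N$ and of $t>\alpha$ (it may depend on the given solution and on $\alpha$). By the usual convention, manifolds are connected and without boundary. *)

theory Defs
  imports "HOL-Analysis.Analysis"
begin

subsection \<open>Smooth manifolds\<close>

text \<open>
  \<open>Ck_on k f S\<close> is meant for open \<open>S\<close>: all iterated partial derivatives of \<open>f\<close> up to order \<open>k\<close>
  exist and are continuous on \<open>S\<close>.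
\<close>

primrec Ck_on :: "nat \<Rightarrow> ('e::euclidean_space \<Rightarrow> 'f::real_normed_vector) \<Rightarrow> 'e set \<Rightarrow> bool" where
  "Ck_on 0 f S \<longleftrightarrow> continuous_on S f"
| "Ck_on (Suc k) f S \<longleftrightarrow> f differentiable_on S \<and>
     (\<forall>b\<in>Basis. Ck_on k (\<lambda>x. frechet_derivative f (at x) b) S)"

definition smooth_on :: "('e::euclidean_space \<Rightarrow> 'f::real_normed_vector) \<Rightarrow> 'e set \<Rightarrow> bool" where
  "smooth_on f S \<longleftrightarrow> (\<forall>k. Ck_on k f S)"

text \<open>
  A chart \<open>(U, \<phi>)\<close> consists of its domain and its coordinate map into the model space \<open>'e\<close>;
  the dimension of the manifold is \<open>DIM('e)\<close>. Values of \<open>\<phi>\<close> outside \<open>U\<close> are irrelevant.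
  An atlas is a family of charts indexed by a type \<open>'i\<close>.
\<close>

type_synonym ('a, 'e) chart = "'a set \<times> ('a \<Rightarrow> 'e)"
type_synonym ('i, 'a, 'e) atlas = "'i \<Rightarrow> ('a, 'e) chart"

definition chart_image :: "('a, 'e) chart \<Rightarrow> 'e set" where
  "chart_image c = snd c ` fst c"

definition chart_inv :: "('a, 'e) chart \<Rightarrow> 'e \<Rightarrow> 'a" where
  "chart_inv c = inv_into (fst c) (snd c)"

definition overlap :: "('i, 'a, 'e) atlas \<Rightarrow> 'i \<Rightarrow> 'i \<Rightarrow> 'e set" where
  "overlap A i j = snd (A i) ` (fst (A i) \<inter> fst (A j))"

definition transition :: "('i, 'a, 'e) atlas \<Rightarrow> 'i \<Rightarrow> 'i \<Rightarrow> 'e \<Rightarrow> 'e" where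
  "transition A i j = snd (A j) \<circ> chart_inv (A i)"

definition smooth_manifold :: "'a topology \<Rightarrow> ('i, 'a, 'e::euclidean_space) atlas \<Rightarrow> bool" where
  "smooth_manifold X A \<longleftrightarrow>
     Hausdorff_space X \<and> second_countable X \<and> connected_space X \<and>
     (\<Union>i. fst (A i)) = topspace X \<and>
     (\<forall>i. openin X (fst (A i)) \<and> open (chart_image (A i)) \<and>
          homeomorphic_map (subtopology X (fst (A i))) (top_of_set (chart_image (A i))) (snd (A i))) \<and>
     (\<forall>i j. smooth_on (transition A i j) (overlap A i j))"

definition smooth_time_function ::
    "('i, 'a, 'e::euclidean_space) atlas \<Rightarrow> real set \<Rightarrow> ('a \<Rightarrow> real \<Rightarrow> real) \<Rightarrow> bool" where
  "smooth_time_function A T u \<longleftrightarrow>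
     (\<forall>i. smooth_on (\<lambda>(x, t). u (chart_inv (A i) x) t) (chart_image (A i) \<times> T))"


subsection \<open>Riemannian metrics\<close>

text \<open>
  A field of bilinear forms on (an open set of) the model space, and on a manifold. The latter is
  given by its local expressions: \<open>g i x v w\<close> is the value, at the point with coordinates \<open>x\<close> in
  the chart \<open>A i\<close>, on the tangent vectors with components \<open>v\<close> and \<open>w\<close> in that chart.
\<close>

type_synonym 'e local_form = "'e \<Rightarrow> 'e \<Rightarrow> 'e \<Rightarrow> real"
type_synonym ('i, 'e) form_field = "'i \<Rightarrow> 'e local_form"

definition inner_form :: "('e::euclidean_space \<Rightarrow> 'e \<Rightarrow> real) \<Rightarrow> bool" where
  "inner_form B \<longleftrightarrow> bilinear B \<and> (\<forall>v w. B v w = B w v) \<and> (\<forall>v. v \<noteq> 0 \<longrightarrow> B v v > 0)"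

text \<open>
  A smooth family, over \<open>t \<in> T\<close>, of Riemannian metrics: the local expressions are inner products,
  transform as covariant 2-tensors under changes of chart, and are smooth in \<open>(x, t)\<close>.
\<close>

definition smooth_metric_family ::
    "('i, 'a, 'e::euclidean_space) atlas \<Rightarrow> real set \<Rightarrow> (real \<Rightarrow> ('i, 'e) form_field) \<Rightarrow> bool" where
  "smooth_metric_family A T h \<longleftrightarrow>
     (\<forall>t\<in>T. \<forall>i. \<forall>x\<in>chart_image (A i). inner_form (h t i x)) \<and>
     (\<forall>t\<in>T. \<forall>i j. \<forall>x\<in>overlap A i j. \<forall>v w.
        h t i x v w =
          h t j (transition A i j x)
            (frechet_derivative (transition A i j) (at x) v)
            (frechet_derivative (transition A i j) (at x) w)) \<and>
     (\<forall>i v w. smooth_on (\<lambda>(x, t). h t i x v w) (chart_image (A i) \<times> T))"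


subsection \<open>Local tensor calculus\<close>

text \<open>
  \<open>sharp B \<omega>\<close> raises the index of the covector \<open>\<omega>\<close>: it is the vector \<open>y\<close> representing \<open>\<omega>\<close>
  with respect to the inner product \<open>B\<close>.
\<close>

definition sharp :: "('e::euclidean_space \<Rightarrow> 'e \<Rightarrow> real) \<Rightarrow> ('e \<Rightarrow> real) \<Rightarrow> 'e" where
  "sharp B \<omega> = (THE y. \<forall>z. B y z = \<omega> z)"

lemma sharp_well_defined:
  fixes B :: "'e::euclidean_space \<Rightarrow> 'e \<Rightarrow> real"
  assumes B: "inner_form B" and "linear \<omega>"
  shows "\<exists>!y. \<forall>z. B y z = \<omega> z"
proof -
  have bil: "bilinear B" and pos: "\<And>v. v \<noteq> 0 \<Longrightarrow> B v v > 0"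
    using B by (auto simp: inner_form_def)
  define L where "L y = (\<Sum>b\<in>Basis. B y b *\<^sub>R b)" for y
  have L: "L y \<bullet> z = B y z" for y z
  proof -
    have "B y z = B y (\<Sum>b\<in>Basis. (z \<bullet> b) *\<^sub>R b)"
      by (simp add: euclidean_representation)
    also have "\<dots> = (\<Sum>b\<in>Basis. (z \<bullet> b) * B y b)"
      using bil unfolding bilinear_def
      by (subst linear_sum[where f = "B y"]) (auto simp: linear_cmul)
    finally show ?thesis
      unfolding L_def inner_sum_left inner_scaleR_left by (simp only: inner_commute mult.commute)
  qed
  have lin: "linear L"
    unfolding L_def using bil
    by (intro linearI)
      (simp_all add: bilinear_ladd bilinear_lmul scaleR_add_left sum.distrib scaleR_sum_right)
  have "v = 0" if "L v = 0" for v
    using L[of v v] pos[of v] that by (cases "v = 0") auto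
  then have inj: "inj L"
    using linear_injective_0[OF lin] by blast
  then have surj: "surj L"
    using lin linear_injective_imp_surjective by blast
  have \<omega>: "\<omega> z = (\<Sum>b\<in>Basis. \<omega> b *\<^sub>R b) \<bullet> z" for z
  proof -
    have "\<omega> z = \<omega> (\<Sum>b\<in>Basis. (z \<bullet> b) *\<^sub>R b)"
      by (simp add: euclidean_representation)
    also have "\<dots> = (\<Sum>b\<in>Basis. (z \<bullet> b) * \<omega> b)"
      using assms(2) by (subst linear_sum[where f = \<omega>]) (auto simp: linear_cmul)
    finally show ?thesis
      unfolding inner_sum_left inner_scaleR_left by (simp only: inner_commute mult.commute)
  qed
  obtain y where y: "L y = (\<Sum>b\<in>Basis. \<omega> b *\<^sub>R b)"
    using surj by (metis surjD)
  have ex: "B y z = \<omega> z" for z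
    unfolding L[of y z, symmetric] y by (rule \<omega>[symmetric])
  have "y = y'" if "\<forall>z. B y z = \<omega> z" "\<forall>z. B y' z = \<omega> z" for y y'
  proof -
    have "L y \<bullet> z = L y' \<bullet> z" for z
      using that by (simp add: L)
    then have "L y = L y'"
      using vector_eq_rdot by blast
    then show ?thesis
      using inj by (simp add: inj_eq)
  qed
  then show ?thesis using ex by blast
qed

text \<open>The inverse matrix \<open>g\<^sup>i\<^sup>j\<close> of the Gram matrix \<open>g\<^sub>i\<^sub>j\<close> in the standard basis.\<close>

definition inv_gram :: "('e::euclidean_space \<Rightarrow> 'e \<Rightarrow> real) \<Rightarrow> 'e \<Rightarrow> 'e \<Rightarrow> real" where
  "inv_gram B i j = sharp B (\<lambda>z. z \<bullet> i) \<bullet> j"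

definition vector_norm :: "('e::euclidean_space \<Rightarrow> 'e \<Rightarrow> real) \<Rightarrow> 'e \<Rightarrow> real" where
  "vector_norm B v = sqrt (B v v)"

definition tensor2_norm :: "('e::euclidean_space \<Rightarrow> 'e \<Rightarrow> real) \<Rightarrow> ('e \<Rightarrow> 'e \<Rightarrow> real) \<Rightarrow> real" where
  "tensor2_norm B S = sqrt (\<Sum>a\<in>Basis. \<Sum>b\<in>Basis. \<Sum>a'\<in>Basis. \<Sum>b'\<in>Basis.
     inv_gram B a a' * inv_gram B b b' * S a b * S a' b')"

definition tensor4_norm ::
    "('e::euclidean_space \<Rightarrow> 'e \<Rightarrow> real) \<Rightarrow> ('e \<Rightarrow> 'e \<Rightarrow> 'e \<Rightarrow> 'e \<Rightarrow> real) \<Rightarrow> real" where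
  "tensor4_norm B S = sqrt
     (\<Sum>a\<in>Basis. \<Sum>b\<in>Basis. \<Sum>c\<in>Basis. \<Sum>d\<in>Basis.
      \<Sum>a'\<in>Basis. \<Sum>b'\<in>Basis. \<Sum>c'\<in>Basis. \<Sum>d'\<in>Basis.
        inv_gram B a a' * inv_gram B b b' * inv_gram B c c' * inv_gram B d d' *
        S a b c d * S a' b' c' d')"

text \<open>
  The Christoffel symbols as a bilinear map \<open>\<Gamma>\<^sub>x(v, w)\<close>, i.e.
  \<open>g(\<Gamma>(v,w), z) = (\<partial>\<^sub>v g(w,z) + \<partial>\<^sub>w g(v,z) - \<partial>\<^sub>z g(v,w)) / 2\<close>
  for constant vectors \<open>v\<close>, \<open>w\<close>, \<open>z\<close>.
\<close>

definition christoffel :: "'e::euclidean_space local_form \<Rightarrow> 'e \<Rightarrow> 'e \<Rightarrow> 'e \<Rightarrow> 'e" where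
  "christoffel g x v w = sharp (g x) (\<lambda>z.
     (frechet_derivative (\<lambda>y. g y w z) (at x) v
      + frechet_derivative (\<lambda>y. g y v z) (at x) w
      - frechet_derivative (\<lambda>y. g y v w) (at x) z) / 2)"

text \<open>
  \<open>riemann g x a b c\<close> is \<open>R(a,b)c\<close> with the convention
  \<open>R(a,b)c = \<nabla>\<^sub>a \<nabla>\<^sub>b c - \<nabla>\<^sub>b \<nabla>\<^sub>a c - \<nabla>\<^bsub>[a,b]\<^esub> c\<close>;
  round spheres then have positive Ricci curvature \<open>ricci g x b c = tr (a \<mapsto> R(a,b)c)\<close>.
\<close>

definition riemann :: "'e::euclidean_space local_form \<Rightarrow> 'e \<Rightarrow> 'e \<Rightarrow> 'e \<Rightarrow> 'e \<Rightarrow> 'e" where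
  "riemann g x a b c =
     frechet_derivative (\<lambda>y. christoffel g y b c) (at x) a
     - frechet_derivative (\<lambda>y. christoffel g y a c) (at x) b
     + christoffel g x a (christoffel g x b c)
     - christoffel g x b (christoffel g x a c)"

definition ricci :: "'e::euclidean_space local_form \<Rightarrow> 'e local_form" where
  "ricci g x b c = (\<Sum>a\<in>Basis. riemann g x a b c \<bullet> a)"

definition scalar_curvature :: "'e::euclidean_space local_form \<Rightarrow> 'e \<Rightarrow> real" where
  "scalar_curvature g x = (\<Sum>a\<in>Basis. \<Sum>b\<in>Basis. inv_gram (g x) a b * ricci g x a b)"

definition riemann_norm :: "'e::euclidean_space local_form \<Rightarrow> 'e \<Rightarrow> real" where
  "riemann_norm g x = tensor4_norm (g x) (\<lambda>a b c d. g x (riemann g x a b c) d)"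

definition gradient :: "'e::euclidean_space local_form \<Rightarrow> ('e \<Rightarrow> real) \<Rightarrow> 'e \<Rightarrow> 'e" where
  "gradient g f x = sharp (g x) (frechet_derivative f (at x))"

definition hessian :: "'e::euclidean_space local_form \<Rightarrow> ('e \<Rightarrow> real) \<Rightarrow> 'e local_form" where
  "hessian g f x v w =
     frechet_derivative (\<lambda>y. frechet_derivative f (at y) w) (at x) v
     - frechet_derivative f (at x) (christoffel g x v w)"


subsection \<open>Ricci flow and warped products\<close>

definition positive_scalar_curvature ::
    "('i, 'a, 'e::euclidean_space) atlas \<Rightarrow> ('i, 'e) form_field \<Rightarrow> bool" where
  "positive_scalar_curvature A g \<longleftrightarrow> (\<forall>i. \<forall>x\<in>chart_image (A i). scalar_curvature (g i) x > 0)"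

definition ricci_flow ::
    "('i, 'a, 'e::euclidean_space) atlas \<Rightarrow> real set \<Rightarrow> (real \<Rightarrow> ('i, 'e) form_field) \<Rightarrow> bool" where
  "ricci_flow A T g \<longleftrightarrow>
     smooth_metric_family A T g \<and>
     (\<forall>t\<in>T. \<forall>i. \<forall>x\<in>chart_image (A i). \<forall>v w.
        ((\<lambda>\<tau>. g \<tau> i x v w) has_real_derivative - 2 * ricci (g t i) x v w) (at t))"

definition type_III_ricci_flow ::
    "('i, 'a, 'e::euclidean_space) atlas \<Rightarrow> (real \<Rightarrow> ('i, 'e) form_field) \<Rightarrow> bool" where
  "type_III_ricci_flow A g \<longleftrightarrow>
     ricci_flow A {0<..} g \<and>
     bdd_above {t * riemann_norm (g t i) x | t i x. t > 0 \<and> x \<in> chart_image (A i)}"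

text \<open>The charts \<open>(p, s) \<mapsto> (\<phi> p, s)\<close> on \<open>U \<times> \<real>\<close> of the product manifold \<open>N \<times> \<real>\<close>.\<close>

definition product_line_atlas :: "('i, 'a, 'e) atlas \<Rightarrow> ('i, 'a \<times> real, 'e \<times> real) atlas" where
  "product_line_atlas A i = (fst (A i) \<times> UNIV, map_prod (snd (A i)) id)"

text \<open>The warped product metric \<open>h + e\<^sup>2\<^sup>f ds\<^sup>2\<close> on \<open>N \<times> \<real>\<close>, in the above charts.\<close>

definition warped_product_metric ::
    "('i, 'a, 'e) atlas \<Rightarrow> ('i, 'e) form_field \<Rightarrow> ('a \<Rightarrow> real) \<Rightarrow> ('i, 'e \<times> real) form_field" where
  "warped_product_metric A h f i = (\<lambda>(x, s) (v, a) (w, b).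
     h i x v w + exp (2 * f (chart_inv (A i) x)) * (a * b))"

end

theory Submission
  imports Defs
begin

text \<open>
  The estimate holds at each time separately, as a consequence of the curvature bound and of the
  compactness of \<open>N\<close>. Write \<open>h\<close> and \<open>u\<close> for the metric and the function at time \<open>t\<close>, \<open>g\<close> for the
  warped product metric, and \<open>K\<close> for the supremum of \<open>t |Rm(g(t))|\<close>.
  
  The curvature tensor of \<open>g\<close> contains two pieces. On vectors tangent to \<open>N\<close> it is the curvature tensor
  of \<open>h\<close>; with two entries equal to the unit vector in the direction of \<open>s\<close> it is, up to sign,
  \<open>S = D\<^sup>2u + du \<otimes> du\<close>. The norm of a tensor is the square root of the sum of the squares of its
  components in an orthonormal frame, and an orthonormal frame of \<open>h\<close> together with \<open>e\<^sup>-\<^sup>u \<partial>\<^sub>s\<close> is one of \<open>g\<close>.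
  So both \<open>|Rm(h)|\<close> and \<open>|S|\<close> are at most \<open>|Rm(g)| \<le> K / t\<close>
  (\<open>riemann_norm_le_warped\<close>, \<open>mixed_curvature_le_warped\<close>).
  
  It remains to bound the gradient, since \<open>D\<^sup>2u = S - du \<otimes> du\<close>. Since \<open>N\<close> is compact,
  \<open>|\<nabla>u|\<^sup>2\<close> attains its maximum. There its differential \<open>2 D\<^sup>2u(\<cdot>, \<nabla>u)\<close> vanishes, so that
  \<open>|\<nabla>u|\<^sup>4 = D\<^sup>2u(\<nabla>u, \<nabla>u) + du(\<nabla>u)\<^sup>2 = S(\<nabla>u, \<nabla>u) \<le> |S| |\<nabla>u|\<^sup>2\<close>.
  Hence \<open>|\<nabla>u|\<^sup>2 \<le> K / t\<close> at the maximum and therefore everywhere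
  (\<open>grad_sq_le_at_critical\<close>, \<open>grad_sq_le_mixed_curvature\<close>). Finally
  \<open>t |D\<^sup>2u|\<^sup>2 \<le> 2t (|S|\<^sup>2 + |\<nabla>u|\<^sup>4) \<le> 4K\<^sup>2 / t\<close>, and this is where \<open>t > \<alpha>\<close> enters: the square of the
  Hessian decays like \<open>1 / t\<^sup>2\<close>, which is bounded by a multiple of \<open>1 / t\<close> only away from \<open>t = 0\<close>.
\<close>

section \<open>Tensor norms in orthonormal frames\<close>

text \<open>
  The tensor norms evaluate a tensor only on the standard basis, so no multilinearity is built into them.
  Extending linearly from the basis, one slot at a time, gives arbitrary families of components a value on
  frame vectors.
\<close>

definition lin_ext :: "('e::euclidean_space \<Rightarrow> real) \<Rightarrow> 'e \<Rightarrow> real" where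
  "lin_ext S v = (\<Sum>a\<in>Basis. (v \<bullet> a) * S a)"

lemma lin_ext_linear: "linear S \<Longrightarrow> lin_ext S v = S v"
  unfolding lin_ext_def
  using linear_sum[of S "\<lambda>a. (v \<bullet> a) *\<^sub>R a" Basis]
  by (simp add: linear_cmul euclidean_representation)

lemma lin_ext_divide: "lin_ext (\<lambda>a. S a / c) v = lin_ext S v / c"
  by (simp add: lin_ext_def sum_divide_distrib)

lemma sum_Basis_prod:
  fixes f :: "'e::euclidean_space \<times> 'f::euclidean_space \<Rightarrow> real"
  shows "sum f Basis = (\<Sum>i\<in>Basis. f (i, 0)) + (\<Sum>j\<in>Basis. f (0, j))"
proof -
  have "inj_on (\<lambda>i::'e. (i, 0::'f)) Basis" "inj_on (\<lambda>j::'f. (0::'e, j)) Basis"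
    by (auto simp: inj_on_def)
  moreover have "(\<lambda>i::'e. (i, 0::'f)) ` Basis \<inter> (\<lambda>j::'f. (0::'e, j)) ` Basis = {}"
    by auto
  ultimately show ?thesis
    unfolding Basis_prod_def by (simp add: sum.union_disjoint sum.reindex)
qed

lemma lin_ext_prod_fst: "lin_ext S (v, 0::real) = lin_ext (\<lambda>a. S (a, 0)) v"
  by (simp add: lin_ext_def sum_Basis_prod)

lemma lin_ext_prod_snd: "lin_ext S (0, r::real) = r * S (0, 1)"
  by (simp add: lin_ext_def sum_Basis_prod)

definition orthonormal_frame :: "('e::euclidean_space \<Rightarrow> 'e \<Rightarrow> real) \<Rightarrow> 'e set \<Rightarrow> bool" where
  "orthonormal_frame B E \<longleftrightarrow> finite E \<and>
     (\<forall>e\<in>E. \<forall>e'\<in>E. B e e' = (if e = e' then 1 else 0)) \<and>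
     (\<forall>v. v = (\<Sum>e\<in>E. B v e *\<^sub>R e))"

lemma inner_form_linear:
  assumes "inner_form B"
  shows "linear (B v)" "linear (\<lambda>v. B v w)" "B v w = B w v" "v \<noteq> 0 \<Longrightarrow> B v v > 0"
  using assms by (auto simp: inner_form_def bilinear_def)

lemma inner_form_nonneg: "inner_form B \<Longrightarrow> B v v \<ge> 0"
  by (metis inner_form_linear(1,4) linear_0 order_le_less)

lemma inner_form_eqI:
  assumes "inner_form B" "\<And>z. B v z = B w z"
  shows "v = w"
proof (rule ccontr)
  assume "v \<noteq> w"
  then have "B (v - w) (v - w) > 0"
    by (intro inner_form_linear(4)[OF assms(1)]) auto
  moreover have "B (v - w) (v - w) = B v (v - w) - B w (v - w)"
    using linear_diff[OF inner_form_linear(2)[OF assms(1)]] .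
  ultimately show False using assms(2) by simp
qed

lemma orthonormal_independent:
  assumes "inner_form B" "finite E" "\<forall>e\<in>E. \<forall>e'\<in>E. B e e' = (if e = e' then 1 else 0)"
  shows "independent E"
proof (rule independent_if_scalars_zero[OF assms(2)])
  fix c e assume *: "(\<Sum>x\<in>E. c x *\<^sub>R x) = 0" and e: "e \<in> E"
  have "0 = B e (\<Sum>x\<in>E. c x *\<^sub>R x)"
    using * linear_0[OF inner_form_linear(1)[OF assms(1)]] by simp
  also have "\<dots> = (\<Sum>x\<in>E. c x * B e x)"
    by (simp add: linear_sum[OF inner_form_linear(1)[OF assms(1)]]
        linear_cmul[OF inner_form_linear(1)[OF assms(1)]])
  also have "\<dots> = (\<Sum>x\<in>E. if x = e then c x else 0)"
    using assms(3) e by (intro sum.cong) auto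
  also have "\<dots> = c e" using e assms(2) by simp
  finally show "c e = 0" by simp
qed

text \<open>
  Orthonormal sets are independent, hence of bounded size. An orthonormal set of maximal size spans, for
  otherwise the normalised orthogonal remainder of some vector could be added to it.
\<close>

lemma orthonormal_frame_exists:
  fixes B :: "'e::euclidean_space \<Rightarrow> 'e \<Rightarrow> real"
  assumes B: "inner_form B"
  shows "\<exists>E. orthonormal_frame B E"
proof -
  define P where
    "P E \<longleftrightarrow> finite E \<and> (\<forall>e\<in>E. \<forall>e'\<in>E. B e e' = (if e = e' then 1 else 0))" for E
  have "card E < Suc DIM('e)" if "P E" for E
    using orthonormal_independent[OF B] independent_bound[of E] that by (simp add: P_def)
  moreover have "P {}" by (simp add: P_def)
  ultimately obtain E where "P E" and max: "\<And>E'. P E' \<Longrightarrow> card E' \<le> card E"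
    using ex_has_greatest_nat[of P "{}" card] by blast
  then have E: "finite E" "\<And>e e'. e \<in> E \<Longrightarrow> e' \<in> E \<Longrightarrow> B e e' = (if e = e' then 1 else 0)"
    by (auto simp: P_def)
  note linB = inner_form_linear[OF B]
  have "v = (\<Sum>e\<in>E. B v e *\<^sub>R e)" for v
  proof (rule ccontr)
    assume neq: "v \<noteq> (\<Sum>e\<in>E. B v e *\<^sub>R e)"
    define w where "w = v - (\<Sum>e\<in>E. B v e *\<^sub>R e)"
    have w0: "B w w > 0" using neq by (intro linB(4)) (simp add: w_def)
    have orth: "B w e = 0" if e: "e \<in> E" for e
    proof -
      have "B w e = B v e - (\<Sum>x\<in>E. B v x * B x e)"
        by (simp add: w_def linear_diff[OF linB(2)] linear_sum[OF linB(2)] linear_cmul[OF linB(2)])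
      also have "(\<Sum>x\<in>E. B v x * B x e) = (\<Sum>x\<in>E. if x = e then B v x else 0)"
        using E e by (intro sum.cong) auto
      also have "\<dots> = B v e" using E e by simp
      finally show ?thesis by simp
    qed
    \<comment> \<open>The normalised remainder \<open>n\<close> extends the maximal orthonormal set.\<close>
    define n where "n = (1 / sqrt (B w w)) *\<^sub>R w"
    have nn: "B n n = 1" using w0
      by (simp add: n_def linear_cmul[OF linB(1)] linear_cmul[OF linB(2)] field_simps)
    have ne: "B n e = 0" "B e n = 0" if "e \<in> E" for e
      using orth[OF that] linB(3)[of e n] by (simp_all add: n_def linear_cmul[OF linB(2)])
    have "n \<notin> E" using nn ne(1)[of n] by auto
    moreover have "P (insert n E)" using E nn ne \<open>n \<notin> E\<close> by (auto simp: P_def)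
    ultimately show False using max[of "insert n E"] E by simp
  qed
  then show ?thesis using E unfolding orthonormal_frame_def by blast
qed

lemma sharp_eq:
  assumes "inner_form B" "\<And>z. B y z = \<omega> z"
  shows "sharp B \<omega> = y"
  unfolding sharp_def
proof (rule the_equality)
  show "\<forall>z. B y z = \<omega> z" using assms(2) by blast
  fix y' assume "\<forall>z. B y' z = \<omega> z"
  then show "y' = y" using assms by (intro inner_form_eqI[OF assms(1)]) simp
qed

lemma sharp_works:
  assumes "inner_form B" "linear \<omega>"
  shows "B (sharp B \<omega>) z = \<omega> z"
  using theI'[OF sharp_well_defined[OF assms]] by (simp add: sharp_def)

lemma linear_inner_left: "linear (\<lambda>z. z \<bullet> i)"
  by (simp add: bounded_linear.linear bounded_linear_inner_left)

text \<open>
  The vector that represents the \<open>i\<close>-th coordinate has frame coefficients \<open>e \<bullet> i\<close>. In this factorised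
  form the contractions with the inverse Gram matrix turn into sums of squares.
\<close>

lemma inv_gram_frame:
  assumes B: "inner_form B" and E: "orthonormal_frame B E"
  shows "inv_gram B i j = (\<Sum>e\<in>E. (e \<bullet> i) * (e \<bullet> j))"
proof -
  let ?y = "sharp B (\<lambda>z. z \<bullet> i)"
  have "?y = (\<Sum>e\<in>E. B ?y e *\<^sub>R e)" using E by (simp add: orthonormal_frame_def)
  also have "\<dots> = (\<Sum>e\<in>E. (e \<bullet> i) *\<^sub>R e)"
    by (simp add: sharp_works[OF B linear_inner_left])
  finally show ?thesis unfolding inv_gram_def by (simp add: inner_sum_left)
qed

lemma parseval:
  assumes B: "inner_form B" and E: "orthonormal_frame B E"
  shows "B v w = (\<Sum>e\<in>E. B v e * B w e)"
proof -
  have "B v w = B v (\<Sum>e\<in>E. B w e *\<^sub>R e)" using E by (simp add: orthonormal_frame_def)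
  then show ?thesis
    by (simp add: linear_sum[OF inner_form_linear(1)[OF B]]
        linear_cmul[OF inner_form_linear(1)[OF B]] mult.commute)
qed

lemma inner_form_Cauchy_Schwarz:
  assumes B: "inner_form B"
  shows "(B v w)\<^sup>2 \<le> B v v * B w w"
proof -
  obtain E where E: "orthonormal_frame B E" using orthonormal_frame_exists[OF B] by blast
  show ?thesis
    using Cauchy_Schwarz_ineq_sum[of "B v" "B w" E]
    by (simp add: parseval[OF B E, of v w] parseval[OF B E, of v v] parseval[OF B E, of w w] power2_eq_square)
qed

lemma sum_gram_square:
  fixes p :: "'k \<Rightarrow> 'i \<Rightarrow> real"
  assumes "finite I" "finite K"
  shows "(\<Sum>i\<in>I. \<Sum>i'\<in>I. (\<Sum>k\<in>K. p k i * p k i') * (S i * S i')) = (\<Sum>k\<in>K. (\<Sum>i\<in>I. p k i * S i)\<^sup>2)"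
proof -
  have "(\<Sum>k\<in>K. (\<Sum>i\<in>I. p k i * S i)\<^sup>2) = (\<Sum>k\<in>K. \<Sum>i\<in>I. \<Sum>i'\<in>I. p k i * p k i' * (S i * S i'))"
    by (simp add: power2_eq_square sum_product mult_ac)
  also have "\<dots> = (\<Sum>i\<in>I. \<Sum>k\<in>K. \<Sum>i'\<in>I. p k i * p k i' * (S i * S i'))"
    by (rule sum.swap)
  also have "\<dots> = (\<Sum>i\<in>I. \<Sum>i'\<in>I. \<Sum>k\<in>K. p k i * p k i' * (S i * S i'))"
    by (intro sum.cong sum.swap refl)
  finally show ?thesis by (simp add: sum_distrib_right)
qed

lemma tensor2_norm_frame:
  assumes B: "inner_form B" and E: "orthonormal_frame B E"
  shows "(tensor2_norm B S)\<^sup>2 = (\<Sum>k\<in>E. \<Sum>l\<in>E. (lin_ext (\<lambda>a. lin_ext (S a) l) k)\<^sup>2)" (is "_ = ?R")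
    and "tensor2_norm B S \<ge> 0"
proof -
  have fE: "finite E" using E by (simp add: orthonormal_frame_def)
  define p where "p = (\<lambda>(k::'a, l::'a) (a::'a, b::'a). (k \<bullet> a) * (l \<bullet> b))"
  let ?I = "Basis \<times> Basis :: ('a \<times> 'a) set"
  let ?K = "E \<times> E"
  let ?S = "\<lambda>(a, b). S a b"
  have M: "inv_gram B a a' * inv_gram B b b' = (\<Sum>k\<in>?K. p k (a, b) * p k (a', b'))" for a a' b b'
    unfolding inv_gram_frame[OF B E] sum_product sum.cartesian_product p_def
    by (intro sum.cong) (auto simp: mult_ac)
  have "(\<Sum>a\<in>Basis. \<Sum>b\<in>Basis. \<Sum>a'\<in>Basis. \<Sum>b'\<in>Basis.
     inv_gram B a a' * inv_gram B b b' * S a b * S a' b')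
    = (\<Sum>i\<in>?I. \<Sum>i'\<in>?I. (\<Sum>k\<in>?K. p k i * p k i') * (?S i * ?S i'))"
    unfolding M by (simp add: sum.cartesian_product' mult.assoc)
  also have "\<dots> = (\<Sum>k\<in>?K. (\<Sum>i\<in>?I. p k i * ?S i)\<^sup>2)"
    by (rule sum_gram_square) (use fE in auto)
  also have "\<dots> = ?R"
    by (simp add: sum.cartesian_product' p_def lin_ext_def sum_distrib_left mult_ac)
  finally have eq: "(\<Sum>a\<in>Basis. \<Sum>b\<in>Basis. \<Sum>a'\<in>Basis. \<Sum>b'\<in>Basis.
     inv_gram B a a' * inv_gram B b b' * S a b * S a' b') = ?R" .
  have "?R \<ge> 0" by (intro sum_nonneg) auto
  then show "(tensor2_norm B S)\<^sup>2 = ?R" "tensor2_norm B S \<ge> 0"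
    unfolding tensor2_norm_def eq by simp_all
qed

lemma tensor2_norm_nonneg: "inner_form B \<Longrightarrow> tensor2_norm B S \<ge> 0"
  using orthonormal_frame_exists tensor2_norm_frame(2) by blast

lemma tensor2_norm_frame_linear:
  assumes "inner_form B" "orthonormal_frame B E" "\<And>w. linear (\<lambda>v. S v w)" "\<And>v. linear (S v)"
  shows "(tensor2_norm B S)\<^sup>2 = (\<Sum>k\<in>E. \<Sum>l\<in>E. (S k l)\<^sup>2)"
  by (simp add: tensor2_norm_frame(1)[OF assms(1,2)] lin_ext_linear assms(3,4))

text \<open>
  In a frame, \<open>S(z, z)\<close> is the Euclidean inner product of the components of \<open>S\<close> with those of \<open>z \<otimes> z\<close>,
  whose norm is \<open>B(z, z)\<close>.
\<close>

lemma tensor2_Cauchy_Schwarz: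
  assumes B: "inner_form B" and lin: "\<And>w. linear (\<lambda>v. S v w)" "\<And>v. linear (S v)"
  shows "\<bar>S z z\<bar> \<le> tensor2_norm B S * B z z"
proof -
  obtain E where E: "orthonormal_frame B E" using orthonormal_frame_exists[OF B] by blast
  define c where "c e = B z e" for e
  have z: "z = (\<Sum>e\<in>E. c e *\<^sub>R e)" using E by (simp add: orthonormal_frame_def c_def)
  have "S z z = S (\<Sum>e\<in>E. c e *\<^sub>R e) (\<Sum>e\<in>E. c e *\<^sub>R e)"
    by (simp only: z[symmetric])
  also have "\<dots> = (\<Sum>k\<in>E. c k * (\<Sum>l\<in>E. c l * S k l))"
    by (simp only: linear_sum[OF lin(1)] linear_cmul[OF lin(1)] real_scaleR_def)
      (simp add: linear_sum[OF lin(2)] linear_cmul[OF lin(2)])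
  also have "\<dots> = (\<Sum>(k, l)\<in>E \<times> E. (c k * c l) * S k l)"
    by (simp add: sum_distrib_left sum.cartesian_product mult.assoc)
  finally have "(S z z)\<^sup>2 \<le> (\<Sum>p\<in>E \<times> E. (c (fst p) * c (snd p))\<^sup>2) * (\<Sum>p\<in>E \<times> E. (S (fst p) (snd p))\<^sup>2)"
    using Cauchy_Schwarz_ineq_sum[of "\<lambda>p. c (fst p) * c (snd p)" "\<lambda>p. S (fst p) (snd p)" "E \<times> E"]
    by (simp add: case_prod_unfold)
  also have "(\<Sum>p\<in>E \<times> E. (S (fst p) (snd p))\<^sup>2) = (tensor2_norm B S)\<^sup>2"
    unfolding tensor2_norm_frame_linear[OF B E lin] by (simp add: sum.cartesian_product')
  also have "(\<Sum>p\<in>E \<times> E. (c (fst p) * c (snd p))\<^sup>2) = (\<Sum>k\<in>E. (c k)\<^sup>2)\<^sup>2"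
    by (simp add: sum.cartesian_product' power2_eq_square[of "sum _ _"] sum_product power_mult_distrib)
  also have "(\<Sum>k\<in>E. (c k)\<^sup>2) = B z z"
    unfolding parseval[OF B E, of z z] by (simp add: c_def power2_eq_square)
  finally have "\<bar>S z z\<bar>\<^sup>2 \<le> (tensor2_norm B S * B z z)\<^sup>2"
    by (simp add: power_mult_distrib mult.commute)
  then show ?thesis
    by (rule power2_le_imp_le) (intro mult_nonneg_nonneg tensor2_norm_nonneg[OF B] inner_form_nonneg[OF B])
qed

lemma tensor2_norm_cmul: "tensor2_norm B (\<lambda>a b. c * S a b) = \<bar>c\<bar> * tensor2_norm B S"
proof -
  have "(\<Sum>a\<in>Basis. \<Sum>b\<in>Basis. \<Sum>a'\<in>Basis. \<Sum>b'\<in>Basis.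
     inv_gram B a a' * inv_gram B b b' * (c * S a b) * (c * S a' b'))
   = c\<^sup>2 * (\<Sum>a\<in>Basis. \<Sum>b\<in>Basis. \<Sum>a'\<in>Basis. \<Sum>b'\<in>Basis.
     inv_gram B a a' * inv_gram B b b' * S a b * S a' b')"
    unfolding sum_distrib_left by (intro sum.cong refl) (simp add: power2_eq_square)
  then show ?thesis by (simp add: tensor2_norm_def real_sqrt_mult)
qed

text \<open>
  Both this and the formula for two slots come from \<open>sum_gram_square\<close>, with index tuples in place of \<open>i\<close>
  and tuples of frame vectors in place of \<open>k\<close>.
\<close>

lemma tensor4_norm_frame:
  assumes B: "inner_form B" and E: "orthonormal_frame B E"
  shows "(tensor4_norm B S)\<^sup>2 = (\<Sum>k\<in>E. \<Sum>l\<in>E. \<Sum>m\<in>E. \<Sum>n\<in>E.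
    (lin_ext (\<lambda>a. lin_ext (\<lambda>b. lin_ext (\<lambda>c. lin_ext (S a b c) n) m) l) k)\<^sup>2)" (is "_ = ?R")
    and "tensor4_norm B S \<ge> 0"
proof -
  have fE: "finite E" using E by (simp add: orthonormal_frame_def)
  define p where "p = (\<lambda>(k::'a, l::'a, m::'a, n::'a) (a::'a, b::'a, c::'a, d::'a).
     (k \<bullet> a) * (l \<bullet> b) * (m \<bullet> c) * (n \<bullet> d))"
  let ?I = "Basis \<times> Basis \<times> Basis \<times> Basis :: ('a \<times> 'a \<times> 'a \<times> 'a) set"
  let ?K = "E \<times> E \<times> E \<times> E"
  let ?S = "\<lambda>(a, b, c, d). S a b c d"
  have M: "inv_gram B a a' * inv_gram B b b' * inv_gram B c c' * inv_gram B d d'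
     = (\<Sum>k\<in>?K. p k (a, b, c, d) * p k (a', b', c', d'))" for a a' b b' c c' d d'
  proof -
    have "(\<Sum>k\<in>?K. p k (a, b, c, d) * p k (a', b', c', d'))
      = (\<Sum>k\<in>E. \<Sum>l\<in>E. \<Sum>m\<in>E. \<Sum>n\<in>E.
           (k \<bullet> a * (k \<bullet> a')) * ((l \<bullet> b * (l \<bullet> b')) * ((m \<bullet> c * (m \<bullet> c')) * (n \<bullet> d * (n \<bullet> d')))))"
      by (simp add: sum.cartesian_product' p_def mult_ac)
    also have "\<dots> = inv_gram B a a' * (inv_gram B b b' * (inv_gram B c c' * inv_gram B d d'))"
      by (simp only: inv_gram_frame[OF B E] sum_distrib_left[symmetric] sum_distrib_right[symmetric])
    finally show ?thesis by (simp add: mult.assoc)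
  qed
  have "(\<Sum>a\<in>Basis. \<Sum>b\<in>Basis. \<Sum>c\<in>Basis. \<Sum>d\<in>Basis.
      \<Sum>a'\<in>Basis. \<Sum>b'\<in>Basis. \<Sum>c'\<in>Basis. \<Sum>d'\<in>Basis.
        inv_gram B a a' * inv_gram B b b' * inv_gram B c c' * inv_gram B d d' *
        S a b c d * S a' b' c' d')
    = (\<Sum>i\<in>?I. \<Sum>i'\<in>?I. (\<Sum>k\<in>?K. p k i * p k i') * (?S i * ?S i'))"
    unfolding M by (simp add: sum.cartesian_product' mult.assoc del: sum.cartesian_product)
  also have "\<dots> = (\<Sum>k\<in>?K. (\<Sum>i\<in>?I. p k i * ?S i)\<^sup>2)"
    by (rule sum_gram_square) (use fE in auto)
  also have "\<dots> = ?R"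
    by (simp add: sum.cartesian_product' p_def lin_ext_def sum_distrib_left mult_ac)
  finally have eq: "(\<Sum>a\<in>Basis. \<Sum>b\<in>Basis. \<Sum>c\<in>Basis. \<Sum>d\<in>Basis.
      \<Sum>a'\<in>Basis. \<Sum>b'\<in>Basis. \<Sum>c'\<in>Basis. \<Sum>d'\<in>Basis.
        inv_gram B a a' * inv_gram B b b' * inv_gram B c c' * inv_gram B d d' *
        S a b c d * S a' b' c' d') = ?R" .
  have "?R \<ge> 0" by (intro sum_nonneg) auto
  then show "(tensor4_norm B S)\<^sup>2 = ?R" "tensor4_norm B S \<ge> 0"
    unfolding tensor4_norm_def eq by simp_all
qed

text \<open>
  The inner product of a warped product at one point; there \<open>r = e\<^sup>u\<close>.
\<close>

definition block_form :: "('e \<Rightarrow> 'e \<Rightarrow> real) \<Rightarrow> real \<Rightarrow> 'e \<times> real \<Rightarrow> 'e \<times> real \<Rightarrow> real" where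
  "block_form B r = (\<lambda>(v, a) (w, b). B v w + r\<^sup>2 * (a * b))"

lemma block_form_simp [simp]: "block_form B r (v, a) (w, b) = B v w + r\<^sup>2 * (a * b)"
  by (simp add: block_form_def)

lemma inner_form_block:
  assumes B: "inner_form B" and "r > 0"
  shows "inner_form (block_form B r)"
proof -
  note linB = inner_form_linear[OF B]
  have "bilinear (block_form B r)"
    unfolding bilinear_def
    by (auto intro!: linearI simp: linear_add[OF linB(1)] linear_add[OF linB(2)]
        linear_cmul[OF linB(1)] linear_cmul[OF linB(2)] algebra_simps)
  moreover have "block_form B r v w = block_form B r w v" for v w
    by (cases v; cases w) (simp add: linB(3) mult_ac)
  moreover have "block_form B r v v > 0" if "v \<noteq> 0" for v
  proof (cases v)
    case (Pair x a)
    show ?thesis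
    proof (cases "x = 0")
      case True
      then have "a \<noteq> 0" using that Pair by (simp add: zero_prod_def)
      then show ?thesis using \<open>r > 0\<close> True Pair linear_0[OF linB(1)]
        by (simp add: zero_less_mult_iff) linarith
    next
      case False
      then show ?thesis using linB(4)[OF False] Pair by (simp add: add_pos_nonneg)
    qed
  qed
  ultimately show ?thesis unfolding inner_form_def by blast
qed

lemma orthonormal_frame_block:
  assumes B: "inner_form B" and "r > 0" and E: "orthonormal_frame B E"
  shows "orthonormal_frame (block_form B r) (insert (0, 1 / r) ((\<lambda>e. (e, 0)) ` E))"
proof -
  note linB = inner_form_linear[OF B]
  have fE: "finite E" and on: "\<And>e e'. e \<in> E \<Longrightarrow> e' \<in> E \<Longrightarrow> B e e' = (if e = e' then 1 else 0)"
    and rep: "\<And>v. v = (\<Sum>e\<in>E. B v e *\<^sub>R e)"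
    using E by (auto simp: orthonormal_frame_def)
  have B0: "B v 0 = 0" "B 0 v = 0" for v
    using linear_0[OF linB(1)] linear_0[OF linB(2)] by auto
  have inj: "inj_on (\<lambda>e. (e, 0::real)) E" by (auto simp: inj_on_def)
  have notin: "(0, 1 / r) \<notin> (\<lambda>e. (e, 0)) ` E" using \<open>r > 0\<close> by auto
  have "v = (\<Sum>e\<in>insert (0, 1 / r) ((\<lambda>e. (e, 0)) ` E). block_form B r v e *\<^sub>R e)" for v
  proof (cases v)
    case (Pair x a)
    have "(\<Sum>e\<in>insert (0, 1 / r) ((\<lambda>e. (e, 0)) ` E). block_form B r v e *\<^sub>R e)
       = (0, a) + (\<Sum>e\<in>E. (B x e *\<^sub>R e, 0))"
      using fE notin \<open>r > 0\<close> by (simp add: Pair B0 sum.reindex[OF inj] power2_eq_square)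
    also have "(\<Sum>e\<in>E. (B x e *\<^sub>R e, 0::real)) = (x, 0)"
      by (subst (2) rep[of x]) (simp add: sum_prod)
    finally show ?thesis by (simp add: Pair)
  qed
  then show ?thesis unfolding orthonormal_frame_def
    using fE on B0 \<open>r > 0\<close> by (auto simp: power2_eq_square)
qed

text \<open>
  The square of the norm on the product is a sum of squares over quadruples of frame vectors. Keeping only
  the quadruples with entries in \<open>E\<close>, or only those with the unit vector \<open>(0, 1 / r)\<close> in the two middle
  slots and entries of \<open>E\<close> in the outer ones, can only decrease it.
\<close>

lemma tensor4_norm_block_ge:
  fixes B :: "'e::euclidean_space \<Rightarrow> 'e \<Rightarrow> real"
  assumes B: "inner_form B" and r: "r > 0"
  shows "tensor4_norm B (\<lambda>a b c d. S (a, 0) (b, 0) (c, 0) (d, 0)) \<le> tensor4_norm (block_form B r) S"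
    and "tensor2_norm B (\<lambda>a d. S (a, 0) (0, 1) (0, 1) (d, 0)) \<le> r\<^sup>2 * tensor4_norm (block_form B r) S"
proof -
  obtain E where E: "orthonormal_frame B E" using orthonormal_frame_exists[OF B] by blast
  have fE: "finite E" using E by (simp add: orthonormal_frame_def)
  let ?j = "\<lambda>e::'e. (e, 0::real)"
  let ?s = "(0::'e, 1 / r)"
  let ?F = "insert ?s (?j ` E)"
  define T where "T = (\<lambda>(k, l, m, n).
    (lin_ext (\<lambda>a. lin_ext (\<lambda>b. lin_ext (\<lambda>c. lin_ext (S a b c) n) m) l) k)\<^sup>2)"
  have T0: "T x \<ge> 0" for x by (simp add: T_def split: prod.split)
  have fin: "finite (?F \<times> ?F \<times> ?F \<times> ?F)" using fE by auto
  have inj: "inj_on ?j E" by (auto simp: inj_on_def)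
  have norm4: "(tensor4_norm (block_form B r) S)\<^sup>2 = sum T (?F \<times> ?F \<times> ?F \<times> ?F)"
    unfolding tensor4_norm_frame(1)[OF inner_form_block[OF B r] orthonormal_frame_block[OF B r E]] T_def
    by (simp only: sum.cartesian_product' case_prod_conv)
  have nn: "tensor4_norm (block_form B r) S \<ge> 0"
    by (rule tensor4_norm_frame(2)[OF inner_form_block[OF B r] orthonormal_frame_block[OF B r E]])
  have "(tensor4_norm B (\<lambda>a b c d. S (a, 0) (b, 0) (c, 0) (d, 0)))\<^sup>2
     = sum T (?j ` E \<times> ?j ` E \<times> ?j ` E \<times> ?j ` E)"
    unfolding tensor4_norm_frame(1)[OF B E]
    by (simp add: sum.cartesian_product' sum.reindex[OF inj] T_def lin_ext_prod_fst)
  also have "\<dots> \<le> sum T (?F \<times> ?F \<times> ?F \<times> ?F)"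
    by (intro sum_mono2 fin Sigma_mono subset_insertI T0)
  finally show "tensor4_norm B (\<lambda>a b c d. S (a, 0) (b, 0) (c, 0) (d, 0)) \<le> tensor4_norm (block_form B r) S"
    unfolding norm4[symmetric] by (rule power2_le_imp_le[OF _ nn])
  have "(tensor2_norm B (\<lambda>a d. S (a, 0) (0, 1) (0, 1) (d, 0)))\<^sup>2
     = (r\<^sup>2)\<^sup>2 * sum T (?j ` E \<times> {?s} \<times> {?s} \<times> ?j ` E)"
    using r unfolding tensor2_norm_frame(1)[OF B E]
    by (simp add: sum.cartesian_product' sum.reindex[OF inj] T_def lin_ext_prod_fst lin_ext_prod_snd
        lin_ext_divide power_mult_distrib sum_distrib_left power_divide flip: power_add power_mult)
  also have "\<dots> \<le> (r\<^sup>2)\<^sup>2 * sum T (?F \<times> ?F \<times> ?F \<times> ?F)"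
    by (intro mult_left_mono sum_mono2 fin Sigma_mono subset_insertI T0) simp_all
  finally have "(tensor2_norm B (\<lambda>a d. S (a, 0) (0, 1) (0, 1) (d, 0)))\<^sup>2 \<le> (r\<^sup>2 * tensor4_norm (block_form B r) S)\<^sup>2"
    by (simp only: norm4 power_mult_distrib)
  then show "tensor2_norm B (\<lambda>a d. S (a, 0) (0, 1) (0, 1) (d, 0)) \<le> r\<^sup>2 * tensor4_norm (block_form B r) S"
    by (rule power2_le_imp_le) (simp add: nn)
qed

section \<open>Differentiability of the geometric quantities in a chart\<close>

lemma differentiable_transform_open:
  assumes "g differentiable (at x)" "open S" "x \<in> S" "\<And>y. y \<in> S \<Longrightarrow> g y = f y"
  shows "f differentiable (at x)"
  using assms unfolding differentiable_def by (meson has_derivative_transform_within_open)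

lemma Ck_on_cong:
  assumes "open S" "\<And>x. x \<in> S \<Longrightarrow> f x = g x" "Ck_on k f S"
  shows "Ck_on k g S"
  using assms(2,3)
proof (induction k arbitrary: f g)
  case 0
  then show ?case by (simp cong: continuous_on_cong)
next
  case (Suc k)
  then have diff: "f differentiable at x" if "x \<in> S" for x
    using that \<open>open S\<close> by (simp add: differentiable_on_eq_differentiable_at)
  have eq: "frechet_derivative f (at x) = frechet_derivative g (at x)" if "x \<in> S" for x
    by (rule frechet_derivative_transform_within_open[OF diff \<open>open S\<close>]) (use that Suc.prems(1) in auto)
  have "g differentiable_on S"
    using differentiable_transform_open[OF diff \<open>open S\<close>] Suc.prems(1)
    by (auto simp: differentiable_on_eq_differentiable_at[OF \<open>open S\<close>])
  moreover have "Ck_on k (\<lambda>x. frechet_derivative g (at x) b) S" if "b \<in> Basis" for b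
    by (rule Suc.IH[of "\<lambda>x. frechet_derivative f (at x) b"]) (use Suc.prems(2) that eq in auto)
  ultimately show ?case by simp
qed

text \<open>
  Freezing the time variable: partial derivatives of the restriction are restrictions of partial
  derivatives, because \<open>(b, 0)\<close> is a basis vector of the product space.
\<close>

lemma Ck_on_slice:
  fixes F :: "'e::euclidean_space \<times> 'f::euclidean_space \<Rightarrow> 'g::real_normed_vector"
  assumes "open U" "open T" "t \<in> T" "Ck_on k F (U \<times> T)"
  shows "Ck_on k (\<lambda>x. F (x, t)) U"
  using assms(4)
proof (induction k arbitrary: F)
  case 0
  then show ?case using \<open>t \<in> T\<close>
    by (auto intro!: continuous_on_compose2[of "U \<times> T" F] continuous_intros)
next
  case (Suc k)
  have op: "open (U \<times> T)" using assms by (simp add: open_Times)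
  have der: "((\<lambda>x. F (x, t)) has_derivative (\<lambda>v. frechet_derivative F (at (x, t)) (v, 0))) (at x)"
    if "x \<in> U" for x
  proof -
    have "F differentiable at (x, t)"
      using Suc.prems that \<open>t \<in> T\<close> op by (simp add: differentiable_on_eq_differentiable_at)
    then have "(F has_derivative frechet_derivative F (at (x, t))) (at (x, t))"
      using frechet_derivative_works by blast
    moreover have "((\<lambda>x. (x, t)) has_derivative (\<lambda>v. (v, 0))) (at x)"
      by (auto intro!: derivative_eq_intros)
    ultimately show ?thesis
      using has_derivative_compose[of "\<lambda>x. (x, t)" "\<lambda>v. (v, 0)" x UNIV F] by simp
  qed
  have "(\<lambda>x. F (x, t)) differentiable_on U"
    unfolding differentiable_on_eq_differentiable_at[OF \<open>open U\<close>]
    using der differentiableI by blast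
  moreover have "Ck_on k (\<lambda>x. frechet_derivative (\<lambda>x. F (x, t)) (at x) b) U" if "b \<in> Basis" for b
  proof (rule Ck_on_cong[OF \<open>open U\<close>])
    show "Ck_on k (\<lambda>x. frechet_derivative F (at (x, t)) (b, 0)) U"
      using Suc.prems that by (intro Suc.IH) (auto simp: Basis_prod_def)
    show "frechet_derivative F (at (x, t)) (b, 0) = frechet_derivative (\<lambda>x. F (x, t)) (at x) b"
      if "x \<in> U" for x
      by (rule fun_cong[OF frechet_derivative_at[OF der[OF that]]])
  qed
  ultimately show ?case by simp
qed

abbreviation dir_deriv :: "('e::real_normed_vector \<Rightarrow> 'f::real_normed_vector) \<Rightarrow> 'e \<Rightarrow> 'e \<Rightarrow> 'f" where
  "dir_deriv f x v \<equiv> frechet_derivative f (at x) v"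

lemma dir_deriv_eqI: "(f has_derivative f') (at x) \<Longrightarrow> dir_deriv f x v = f' v"
  by (metis frechet_derivative_at)

lemma dir_deriv_works:
  "f differentiable (at x) \<Longrightarrow> (f has_derivative dir_deriv f x) (at x)"
  using frechet_derivative_works by blast

lemma dir_deriv_linear: "f differentiable (at x) \<Longrightarrow> linear (dir_deriv f x)"
  using dir_deriv_works has_derivative_linear by blast

lemma Ck_on_2_differentiable:
  fixes f :: "'e::euclidean_space \<Rightarrow> 'f::real_normed_vector"
  assumes "Ck_on 2 f S" "open S" "x \<in> S"
  shows "f differentiable (at x)" "(\<lambda>y. dir_deriv f y b) differentiable (at x)"
proof -
  have 1: "f differentiable (at y)" if "y \<in> S" for y
    using that assms by (simp add: eval_nat_numeral differentiable_on_eq_differentiable_at)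
  then show "f differentiable (at x)" using assms(3) .
  have 2: "(\<lambda>y. dir_deriv f y i) differentiable (at x)" if "i \<in> Basis" for i
    using that assms by (simp add: eval_nat_numeral differentiable_on_eq_differentiable_at)
  have eq: "(\<Sum>i\<in>Basis. (b \<bullet> i) *\<^sub>R dir_deriv f y i) = dir_deriv f y b" if "y \<in> S" for y
  proof -
    have lin: "linear (dir_deriv f y)" using dir_deriv_linear[OF 1[OF that]] .
    show ?thesis
      using linear_sum[OF lin, of "\<lambda>i. (b \<bullet> i) *\<^sub>R i" Basis]
      by (simp add: linear_cmul[OF lin] euclidean_representation)
  qed
  have "(\<lambda>y. \<Sum>i\<in>Basis. (b \<bullet> i) *\<^sub>R dir_deriv f y i) differentiable (at x)"
    using 2 by (intro differentiable_sum) auto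
  then show "(\<lambda>y. dir_deriv f y b) differentiable (at x)"
    by (rule differentiable_transform_open[OF _ assms(2,3) eq])
qed

lemma differentiable_prod:
  fixes f :: "'i \<Rightarrow> 'e::real_normed_vector \<Rightarrow> real"
  assumes "finite I" "\<And>i. i \<in> I \<Longrightarrow> f i differentiable (at x within S)"
  shows "(\<lambda>y. \<Prod>i\<in>I. f i y) differentiable (at x within S)"
  using assms by (induction I rule: finite_induct) auto

lemma differentiable_det:
  fixes A :: "'e::real_normed_vector \<Rightarrow> real^'n^'n"
  assumes "\<And>i j. (\<lambda>y. A y $ i $ j) differentiable (at x within S)"
  shows "(\<lambda>y. det (A y)) differentiable (at x within S)"
  unfolding det_def using assms
  by (intro differentiable_sum ballI differentiable_mult differentiable_const differentiable_prod)
     (simp_all add: finite_permutations)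

text \<open>
  In coordinates \<open>sharp\<close> solves a linear system with the Gram matrix. By Cramer's rule its components are
  quotients of determinants in the entries of \<open>B\<close> and \<open>\<omega>\<close>, with non-vanishing denominator. This gives
  the differentiability of Christoffel symbols and gradients.
\<close>

lemma differentiable_sharp:
  fixes B :: "'e::real_normed_vector \<Rightarrow> real^'n \<Rightarrow> real^'n \<Rightarrow> real"
  assumes S: "open S" "x \<in> S"
    and B: "\<And>y. y \<in> S \<Longrightarrow> inner_form (B y)" "\<And>v w. (\<lambda>y. B y v w) differentiable (at x)"
    and \<omega>: "\<And>y. y \<in> S \<Longrightarrow> linear (\<omega> y)" "\<And>v. (\<lambda>y. \<omega> y v) differentiable (at x)"
  shows "(\<lambda>y. sharp (B y) (\<omega> y)) differentiable (at x)"
proof -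
  let ?e = "\<lambda>i::'n. axis i (1::real)"
  define A where "A y = (\<chi> i j. B y (?e i) (?e j))" for y
  define b where "b y = (\<chi> i. \<omega> y (?e i))" for y
  define c where "c k y = det (\<chi> i j. if j = k then b y $ i else A y $ i $ j) / det (A y)" for k y
  have mult: "(A y *v z) $ i = B y (?e i) z" if "y \<in> S" for y z i
  proof -
    note lin = inner_form_linear(1)[OF B(1)[OF that]]
    have "B y (?e i) z = B y (?e i) (\<Sum>j\<in>UNIV. z $ j *s ?e j)"
      by (simp only: basis_expansion)
    also have "\<dots> = (\<Sum>j\<in>UNIV. z $ j * B y (?e i) (?e j))"
      by (simp add: linear_sum[OF lin] linear_cmul[OF lin] scalar_mult_eq_scaleR)
    finally show ?thesis
      by (simp add: matrix_vector_mult_def A_def mult.commute)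
  qed
  have det: "det (A y) \<noteq> 0" if "y \<in> S" for y
  proof -
    have "z = 0" if "A y *v z = 0" for z
    proof (rule inner_form_eqI[OF B(1)[OF \<open>y \<in> S\<close>]])
      fix w
      have zero: "B y z (?e i) = 0" for i
        using mult[OF \<open>y \<in> S\<close>, of z i] that inner_form_linear(3)[OF B(1)[OF \<open>y \<in> S\<close>]] by simp
      note lin = inner_form_linear(1)[OF B(1)[OF \<open>y \<in> S\<close>], of z]
      have "B y z w = B y z (\<Sum>j\<in>UNIV. w $ j *s ?e j)" by (simp only: basis_expansion)
      also have "\<dots> = 0"
        by (simp add: linear_sum[OF lin] linear_cmul[OF lin] scalar_mult_eq_scaleR zero)
      finally show "B y z w = B y 0 w"
        using linear_0[OF inner_form_linear(2)[OF B(1)[OF \<open>y \<in> S\<close>]]] by simp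
    qed
    then show ?thesis
      using matrix_left_invertible_ker[of "A y"] invertible_det_nz invertible_left_inverse by metis
  qed
  have eq: "(\<Sum>k\<in>UNIV. c k y *s ?e k) = sharp (B y) (\<omega> y)" if "y \<in> S" for y
  proof -
    have "A y *v sharp (B y) (\<omega> y) = b y"
      using sharp_works[OF B(1) \<omega>(1), OF that that]
      by (simp add: vec_eq_iff mult[OF that] b_def inner_form_linear(3)[OF B(1)[OF that], of "axis _ _"])
    then have "sharp (B y) (\<omega> y) = (\<chi> k. c k y)"
      using cramer[OF det[OF that]] unfolding c_def by blast
    then show ?thesis using basis_expansion[of "\<chi> k. c k y"] by simp
  qed
  have dA: "(\<lambda>y. A y $ i $ j) differentiable (at x)" for i j
    using B(2) by (simp add: A_def)
  have db: "(\<lambda>y. b y $ i) differentiable (at x)" for i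
    using \<omega>(2) by (simp add: b_def)
  have numerator: "(\<lambda>y. det (\<chi> i j. if j = k then b y $ i else A y $ i $ j)) differentiable (at x)" for k
  proof (rule differentiable_det)
    fix i j
    show "(\<lambda>y. (\<chi> i j. if j = k then b y $ i else A y $ i $ j) $ i $ j) differentiable (at x)"
      using dA db by (cases "j = k") simp_all
  qed
  have denominator: "(\<lambda>y. det (A y)) differentiable (at x)"
    by (rule differentiable_det) (rule dA)
  have "c k differentiable (at x)" for k
    unfolding c_def by (rule differentiable_divide[OF numerator denominator det[OF S(2)]])
  then have "(\<lambda>y. \<Sum>k\<in>UNIV. c k y *\<^sub>R ?e k) differentiable (at x)"
    by (intro differentiable_sum differentiable_scaleR) auto
  then show ?thesis
    by (rule differentiable_transform_open[OF _ S]) (rule eq[unfolded scalar_mult_eq_scaleR])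
qed

text \<open>
  Two derivatives of the metric are what makes its curvature a derivative in the classical sense.
\<close>

locale metric_chart =
  fixes U :: "(real^'n) set" and h :: "(real^'n) local_form"
  assumes open_U: "open U"
    and inner_form_h: "x \<in> U \<Longrightarrow> inner_form (h x)"
    and h_C2: "Ck_on 2 (\<lambda>x. h x v w) U"
begin

lemma h_diff: "x \<in> U \<Longrightarrow> (\<lambda>y. h y v w) differentiable (at x)"
  using Ck_on_2_differentiable(1)[OF h_C2 open_U] .

lemma dh_diff: "x \<in> U \<Longrightarrow> (\<lambda>y. dir_deriv (\<lambda>y. h y v w) y b) differentiable (at x)"
  using Ck_on_2_differentiable(2)[OF h_C2 open_U] .

lemma h_expand:
  assumes "x \<in> U"
  shows "h x v w = (\<Sum>i\<in>Basis. \<Sum>j\<in>Basis. (v \<bullet> i) * (w \<bullet> j) * h x i j)"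
proof -
  note lin = inner_form_linear[OF inner_form_h[OF assms]]
  have "h x v w = h x (\<Sum>i\<in>Basis. (v \<bullet> i) *\<^sub>R i) (\<Sum>j\<in>Basis. (w \<bullet> j) *\<^sub>R j)"
    by (simp only: euclidean_representation)
  then show ?thesis
    by (subst sum.swap) (simp only: linear_sum[OF lin(2)] linear_cmul[OF lin(2)] linear_sum[OF lin(1)]
        linear_cmul[OF lin(1)] real_scaleR_def sum_distrib_left mult_ac)
qed

text \<open>
  The Leibniz rule for a metric paired with two vector fields. It is derived from the ordinary product
  rule in the finitely many components, since the metric is only known to be differentiable for fixed
  arguments.
\<close>

lemma h_product_rule:
  assumes x: "x \<in> U" and z: "(z has_derivative z') (at x)" and w: "(w has_derivative w') (at x)"
  shows "((\<lambda>y. h y (z y) (w y)) has_derivative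
     (\<lambda>v. dir_deriv (\<lambda>y. h y (z x) (w x)) x v + h x (z' v) (w x) + h x (z x) (w' v))) (at x)"
proof -
  let ?D = "\<lambda>i j. dir_deriv (\<lambda>y. h y i j) x"
  have dh: "((\<lambda>y. h y i j) has_derivative ?D i j) (at x)" for i j
    by (rule dir_deriv_works[OF h_diff[OF x]])
  have exp0: "?D a b v = (\<Sum>i\<in>Basis. \<Sum>j\<in>Basis. (a \<bullet> i) * (b \<bullet> j) * ?D i j v)" for a b v
  proof (rule dir_deriv_eqI)
    have "((\<lambda>y. \<Sum>i\<in>Basis. \<Sum>j\<in>Basis. (a \<bullet> i) * (b \<bullet> j) * h y i j) has_derivative
      (\<lambda>v. \<Sum>i\<in>Basis. \<Sum>j\<in>Basis. (a \<bullet> i) * (b \<bullet> j) * ?D i j v)) (at x)"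
      by (intro has_derivative_sum has_derivative_mult_right dh)
    then show "((\<lambda>y. h y a b) has_derivative
      (\<lambda>v. \<Sum>i\<in>Basis. \<Sum>j\<in>Basis. (a \<bullet> i) * (b \<bullet> j) * ?D i j v)) (at x)"
      by (rule has_derivative_transform_within_open[OF _ open_U x]) (rule h_expand[symmetric])
  qed
  have "((\<lambda>y. \<Sum>i\<in>Basis. \<Sum>j\<in>Basis. (z y \<bullet> i) * (w y \<bullet> j) * h y i j) has_derivative
      (\<lambda>v. \<Sum>i\<in>Basis. \<Sum>j\<in>Basis. ((z x \<bullet> i) * (w x \<bullet> j)) * ?D i j v +
         ((z x \<bullet> i) * (w' v \<bullet> j) + (z' v \<bullet> i) * (w x \<bullet> j)) * h x i j)) (at x)"
    by (intro has_derivative_sum has_derivative_mult dh has_derivative_inner_left z w)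
  then have "((\<lambda>y. h y (z y) (w y)) has_derivative
      (\<lambda>v. \<Sum>i\<in>Basis. \<Sum>j\<in>Basis. ((z x \<bullet> i) * (w x \<bullet> j)) * ?D i j v +
         ((z x \<bullet> i) * (w' v \<bullet> j) + (z' v \<bullet> i) * (w x \<bullet> j)) * h x i j)) (at x)"
    by (rule has_derivative_transform_within_open[OF _ open_U x]) (rule h_expand[symmetric])
  moreover have "(\<Sum>i\<in>Basis. \<Sum>j\<in>Basis. ((z x \<bullet> i) * (w x \<bullet> j)) * ?D i j v +
         ((z x \<bullet> i) * (w' v \<bullet> j) + (z' v \<bullet> i) * (w x \<bullet> j)) * h x i j)
     = ?D (z x) (w x) v + h x (z' v) (w x) + h x (z x) (w' v)" for v
    unfolding exp0[of "z x" "w x"] h_expand[OF x, of "z' v"] h_expand[OF x, of _ "w' v"]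
    by (simp add: sum.distrib distrib_right add_ac)
  ultimately show ?thesis by simp
qed

lemma dh_linear:
  assumes x: "x \<in> U"
  shows "linear (\<lambda>a. dir_deriv (\<lambda>y. h y a b) x v)" "linear (\<lambda>b. dir_deriv (\<lambda>y. h y a b) x v)"
    "linear (dir_deriv (\<lambda>y. h y a b) x)" "dir_deriv (\<lambda>y. h y a b) x v = dir_deriv (\<lambda>y. h y b a) x v"
proof -
  note der = dir_deriv_works[OF h_diff[OF x]]
  have sym: "dir_deriv (\<lambda>y. h y a b) x v = dir_deriv (\<lambda>y. h y b a) x v" for a b
    by (rule fun_cong[OF frechet_derivative_transform_within_open[OF h_diff[OF x] open_U x]])
      (rule inner_form_linear(3)[OF inner_form_h])
  have lin: "linear (\<lambda>a. dir_deriv (\<lambda>y. h y a b) x v)" for b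
  proof (rule linearI)
    fix a a' :: "real^'n" and r :: real
    note lin = inner_form_linear(2)[OF inner_form_h]
    show "dir_deriv (\<lambda>y. h y (a + a') b) x v = dir_deriv (\<lambda>y. h y a b) x v + dir_deriv (\<lambda>y. h y a' b) x v"
      by (rule dir_deriv_eqI, rule has_derivative_transform_within_open[OF has_derivative_add[OF der der] open_U x])
        (simp add: linear_add[OF lin])
    show "dir_deriv (\<lambda>y. h y (r *\<^sub>R a) b) x v = r *\<^sub>R dir_deriv (\<lambda>y. h y a b) x v"
      unfolding real_scaleR_def
      by (rule dir_deriv_eqI, rule has_derivative_transform_within_open[OF has_derivative_mult_right[OF der] open_U x])
        (simp add: linear_cmul[OF lin])
  qed
  show "linear (\<lambda>a. dir_deriv (\<lambda>y. h y a b) x v)" by (rule lin)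
  show "linear (\<lambda>b. dir_deriv (\<lambda>y. h y a b) x v)" using lin[of a] by (subst sym)
  show "linear (dir_deriv (\<lambda>y. h y a b) x)" by (rule dir_deriv_linear[OF h_diff[OF x]])
  show "dir_deriv (\<lambda>y. h y a b) x v = dir_deriv (\<lambda>y. h y b a) x v" by (rule sym)
qed

text \<open>
  This linearity makes the functional in the definition of the Christoffel symbols representable by
  a vector.
\<close>

lemma linear_koszul:
  assumes "x \<in> U"
  shows "linear (\<lambda>z. (dir_deriv (\<lambda>y. h y w z) x v + dir_deriv (\<lambda>y. h y v z) x w
      - dir_deriv (\<lambda>y. h y v w) x z) / 2)"
proof -
  note lin = dh_linear[OF assms]
  show ?thesis
    by (rule linearI) (simp_all add: linear_add[OF lin(2)] linear_add[OF lin(3)] linear_cmul[OF lin(2)]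
        linear_cmul[OF lin(3)] algebra_simps add_divide_distrib diff_divide_distrib)
qed

lemma christoffel_works:
  assumes "x \<in> U"
  shows "h x (christoffel h x v w) z = (dir_deriv (\<lambda>y. h y w z) x v + dir_deriv (\<lambda>y. h y v z) x w
      - dir_deriv (\<lambda>y. h y v w) x z) / 2"
  unfolding christoffel_def by (rule sharp_works[OF inner_form_h[OF assms] linear_koszul[OF assms]])

lemma christoffel_diff:
  assumes "x \<in> U"
  shows "(\<lambda>y. christoffel h y v w) differentiable (at x)"
  unfolding christoffel_def
proof (rule differentiable_sharp[OF open_U assms inner_form_h h_diff[OF assms] linear_koszul])
  fix z
  show "(\<lambda>y. (dir_deriv (\<lambda>y. h y w z) y v + dir_deriv (\<lambda>y. h y v z) y w
      - dir_deriv (\<lambda>y. h y v w) y z) / 2) differentiable (at x)"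
    by (intro differentiable_divide differentiable_add differentiable_diff dh_diff assms
        differentiable_const) simp
qed

lemma christoffel_linear:
  assumes x: "x \<in> U"
  shows "linear (\<lambda>v. christoffel h x v w)" "linear (christoffel h x v)"
proof -
  note I = inner_form_h[OF x]
  note l = inner_form_linear(2)[OF I] and lin = dh_linear[OF x]
  show "linear (\<lambda>v. christoffel h x v w)"
    by (rule linearI; rule inner_form_eqI[OF I])
      (simp_all add: christoffel_works[OF x] linear_add[OF l] linear_cmul[OF l]
        linear_add[OF lin(1)] linear_add[OF lin(3)] linear_cmul[OF lin(1)] linear_cmul[OF lin(3)]
        algebra_simps add_divide_distrib diff_divide_distrib)
  show "linear (christoffel h x v)"
    by (rule linearI; rule inner_form_eqI[OF I])
      (simp_all add: christoffel_works[OF x] linear_add[OF l] linear_cmul[OF l]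
        linear_add[OF lin(1)] linear_add[OF lin(2)] linear_add[OF lin(3)]
        linear_cmul[OF lin(1)] linear_cmul[OF lin(2)] linear_cmul[OF lin(3)]
        algebra_simps add_divide_distrib diff_divide_distrib)
qed

end

section \<open>Curvature of the warped product\<close>

locale warped_chart = metric_chart U h for U :: "(real^'n) set" and h :: "(real^'n) local_form" +
  fixes f :: "real^'n \<Rightarrow> real"
  assumes f_C2: "Ck_on 2 f U"
begin

lemma f_diff: "x \<in> U \<Longrightarrow> f differentiable (at x)"
  using Ck_on_2_differentiable(1)[OF f_C2 open_U] .

lemma df_diff: "x \<in> U \<Longrightarrow> (\<lambda>y. dir_deriv f y b) differentiable (at x)"
  using Ck_on_2_differentiable(2)[OF f_C2 open_U] .

lemma df_linear: "x \<in> U \<Longrightarrow> linear (dir_deriv f x)"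
  by (rule dir_deriv_linear[OF f_diff])

lemma gradient_works: "x \<in> U \<Longrightarrow> h x (gradient h f x) z = dir_deriv f x z"
  unfolding gradient_def by (rule sharp_works[OF inner_form_h df_linear])

lemma gradient_diff: "x \<in> U \<Longrightarrow> gradient h f differentiable (at x)"
  using differentiable_sharp[OF open_U _ inner_form_h h_diff df_linear df_diff]
  unfolding gradient_def by blast

text \<open>
  The Hessian is the covariant derivative of the gradient: differentiate \<open>h(\<nabla>f, w) = df(w)\<close> and use
  that the connection is compatible with the metric.
\<close>

lemma hessian_eq:
  assumes x: "x \<in> U"
  shows "hessian h f x v w = h x (dir_deriv (gradient h f) x v + christoffel h x v (gradient h f x)) w"
proof -
  let ?z = "gradient h f"
  note l = inner_form_linear[OF inner_form_h[OF x]]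
  have "((\<lambda>y. h y (?z y) w) has_derivative
     (\<lambda>v. dir_deriv (\<lambda>y. h y (?z x) w) x v + h x (dir_deriv ?z x v) w + h x (?z x) 0)) (at x)"
    by (rule h_product_rule[OF x dir_deriv_works[OF gradient_diff[OF x]] has_derivative_const])
  then have "((\<lambda>y. dir_deriv f y w) has_derivative
     (\<lambda>v. dir_deriv (\<lambda>y. h y (?z x) w) x v + h x (dir_deriv ?z x v) w + h x (?z x) 0)) (at x)"
    by (rule has_derivative_transform_within_open[OF _ open_U x]) (rule gradient_works)
  then have "dir_deriv (\<lambda>y. dir_deriv f y w) x v
    = dir_deriv (\<lambda>y. h y (?z x) w) x v + h x (dir_deriv ?z x v) w"
    using linear_0[OF l(1)] by (simp add: dir_deriv_eqI)
  moreover have "dir_deriv f x (christoffel h x v w) = h x (christoffel h x v w) (?z x)"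
    using gradient_works[OF x] l(3)[of _ "?z x"] by simp
  ultimately show ?thesis
    unfolding hessian_def
    using dh_linear(4)[OF x, of w "?z x"] dh_linear(4)[OF x, of v "?z x"] dh_linear(4)[OF x, of v w]
    by (simp add: linear_add[OF l(2)] christoffel_works[OF x] field_simps)
qed

lemma hessian_linear:
  assumes x: "x \<in> U"
  shows "linear (\<lambda>v. hessian h f x v w)" "linear (hessian h f x v)"
proof -
  note l = inner_form_linear[OF inner_form_h[OF x]]
  note d = dir_deriv_linear[OF gradient_diff[OF x]] and c = christoffel_linear(1)[OF x]
  show "linear (\<lambda>v. hessian h f x v w)"
    unfolding hessian_eq[OF x]
    by (rule linearI) (simp_all add: linear_add[OF d] linear_add[OF c] linear_cmul[OF d] linear_cmul[OF c]
        linear_add[OF l(2)] linear_cmul[OF l(2)] algebra_simps)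
  show "linear (hessian h f x v)"
    unfolding hessian_eq[OF x] by (rule l(1))
qed

definition grad_sq :: "real^'n \<Rightarrow> real" where
  "grad_sq x = h x (gradient h f x) (gradient h f x)"

lemma grad_sq_nonneg: "x \<in> U \<Longrightarrow> grad_sq x \<ge> 0"
  unfolding grad_sq_def by (rule inner_form_nonneg[OF inner_form_h])

text \<open>
  Metric compatibility again: \<open>d|\<nabla>f|\<^sup>2 = 2 h(\<nabla>\<^sub>v\<nabla>f, \<nabla>f)\<close>.
\<close>

lemma grad_sq_has_derivative:
  assumes x: "x \<in> U"
  shows "(grad_sq has_derivative (\<lambda>v. 2 * hessian h f x v (gradient h f x))) (at x)"
proof -
  let ?z = "gradient h f"
  note l = inner_form_linear[OF inner_form_h[OF x]]
  note d = dir_deriv_works[OF gradient_diff[OF x]]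
  have "(grad_sq has_derivative (\<lambda>v. dir_deriv (\<lambda>y. h y (?z x) (?z x)) x v
     + h x (dir_deriv ?z x v) (?z x) + h x (?z x) (dir_deriv ?z x v))) (at x)"
    unfolding grad_sq_def by (rule h_product_rule[OF x d d])
  moreover have "dir_deriv (\<lambda>y. h y (?z x) (?z x)) x v + h x (dir_deriv ?z x v) (?z x)
      + h x (?z x) (dir_deriv ?z x v) = 2 * hessian h f x v (?z x)" for v
    using l(3)[of "?z x" "dir_deriv ?z x v"] dh_linear(4)[OF x, of v "?z x"]
    by (simp add: hessian_eq[OF x] linear_add[OF l(2)] christoffel_works[OF x])
  ultimately show ?thesis by simp
qed

definition warped_metric :: "((real^'n) \<times> real) local_form" where
  "warped_metric = (\<lambda>(x, s) (v, a) (w, b). h x v w + exp (2 * f x) * (a * b))"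

lemma warped_metric_simp: "warped_metric (x, s) (v, a) (w, b) = h x v w + exp (2 * f x) * (a * b)"
  by (simp add: warped_metric_def)

lemma warped_metric_block: "warped_metric (x, s) = block_form (h x) (exp (f x))"
  by (auto simp: fun_eq_iff warped_metric_def block_form_def exp_double)

lemma inner_form_warped_metric: "x \<in> U \<Longrightarrow> inner_form (warped_metric (x, s))"
  unfolding warped_metric_block by (rule inner_form_block[OF inner_form_h]) simp_all

lemma dir_deriv_warped_metric:
  assumes x: "x \<in> U"
  shows "dir_deriv (\<lambda>p. warped_metric p (w, b) (z, c)) (x, s) (v, a)
     = dir_deriv (\<lambda>y. h y w z) x v + 2 * exp (2 * f x) * dir_deriv f x v * (b * c)"
proof -
  have h: "((\<lambda>p. h (fst p) w z) has_derivative (\<lambda>p. dir_deriv (\<lambda>y. h y w z) x (fst p))) (at (x, s))"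
    by (rule has_derivative_compose[of fst fst "(x, s)" UNIV "\<lambda>y. h y w z"])
      (simp_all add: dir_deriv_works[OF h_diff[OF x]] bounded_linear_fst bounded_linear_imp_has_derivative)
  have f: "((\<lambda>p. f (fst p)) has_derivative (\<lambda>p. dir_deriv f x (fst p))) (at (x, s))"
    by (rule has_derivative_compose[of fst fst "(x, s)" UNIV f])
      (simp_all add: dir_deriv_works[OF f_diff[OF x]] bounded_linear_fst bounded_linear_imp_has_derivative)
  have "((\<lambda>p. h (fst p) w z + exp (2 * f (fst p)) * (b * c)) has_derivative
     (\<lambda>p. dir_deriv (\<lambda>y. h y w z) x (fst p)
         + 2 * exp (2 * f x) * dir_deriv f x (fst p) * (b * c))) (at (x, s))"
    by (auto intro!: derivative_eq_intros h f)
  then have "((\<lambda>p. warped_metric p (w, b) (z, c)) has_derivative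
     (\<lambda>p. dir_deriv (\<lambda>y. h y w z) x (fst p)
         + 2 * exp (2 * f x) * dir_deriv f x (fst p) * (b * c))) (at (x, s))"
    by (simp add: warped_metric_def case_prod_unfold)
  then show ?thesis by (simp add: dir_deriv_eqI)
qed

lemma christoffel_warped_metric:
  assumes x: "x \<in> U"
  shows "christoffel warped_metric (x, s) (v, a) (w, b) =
    (christoffel h x v w - (a * b * exp (2 * f x)) *\<^sub>R gradient h f x,
     b * dir_deriv f x v + a * dir_deriv f x w)"
  unfolding christoffel_def[of warped_metric]
proof (rule sharp_eq[OF inner_form_warped_metric[OF x]])
  fix z :: "(real^'n) \<times> real"
  note l = inner_form_linear[OF inner_form_h[OF x]]
  show "warped_metric (x, s) (christoffel h x v w - (a * b * exp (2 * f x)) *\<^sub>R gradient h f x,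
     b * dir_deriv f x v + a * dir_deriv f x w) z =
     (dir_deriv (\<lambda>y. warped_metric y (w, b) z) (x, s) (v, a) + dir_deriv (\<lambda>y. warped_metric y (v, a) z) (x, s) (w, b)
      - dir_deriv (\<lambda>y. warped_metric y (v, a) (w, b)) (x, s) z) / 2"
    by (cases z) (simp add: warped_metric_simp dir_deriv_warped_metric[OF x] linear_diff[OF l(2)] linear_cmul[OF l(2)]
        christoffel_works[OF x] gradient_works[OF x] field_simps)
qed

text \<open>
  The Christoffel symbols of the warped product are functions of the base point alone, so their
  derivatives are taken through the projection to the base.
\<close>

lemma dir_deriv_product:
  fixes F :: "(real^'n) \<times> real \<Rightarrow> (real^'n) \<times> real"
  assumes x: "x \<in> U" and eq: "\<And>y r. y \<in> U \<Longrightarrow> F (y, r) = (p y, q y)"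
    and p: "(p has_derivative p') (at x)" and q: "(q has_derivative q') (at x)"
  shows "dir_deriv F (x, s) (v, a) = (p' v, q' v)"
proof -
  have "((\<lambda>y. p (fst y)) has_derivative (\<lambda>v. p' (fst v))) (at (x, s))"
    "((\<lambda>y. q (fst y)) has_derivative (\<lambda>v. q' (fst v))) (at (x, s))"
    using has_derivative_compose[of fst fst "(x, s)" UNIV] p q
    by (simp_all add: bounded_linear_fst bounded_linear_imp_has_derivative)
  then have "((\<lambda>y. (p (fst y), q (fst y))) has_derivative (\<lambda>v. (p' (fst v), q' (fst v)))) (at (x, s))"
    by (rule has_derivative_Pair)
  then have "(F has_derivative (\<lambda>v. (p' (fst v), q' (fst v)))) (at (x, s))"
    by (rule has_derivative_transform_within_open[of _ _ _ _ "U \<times> UNIV"])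
      (use x open_U eq in \<open>auto intro: open_Times\<close>)
  then show ?thesis by (simp add: dir_deriv_eqI)
qed

text \<open>
  The slices \<open>N \<times> {s}\<close> are totally geodesic, being fixed by the reflections in the \<open>s\<close> direction.
\<close>

lemma riemann_warped_metric_base:
  assumes x: "x \<in> U"
  shows "riemann warped_metric (x, s) (a, 0) (b, 0) (c, 0) = (riemann h x a b c, 0)"
proof -
  have "dir_deriv (\<lambda>y. christoffel warped_metric y (b, 0) (c, 0)) (x, s) (v, 0)
      = (dir_deriv (\<lambda>y. christoffel h y b c) x v, 0)" for b c v
    by (rule dir_deriv_product[OF x _ dir_deriv_works[OF christoffel_diff[OF x]] has_derivative_const])
      (simp add: christoffel_warped_metric)
  then show ?thesis
    by (simp add: riemann_def christoffel_warped_metric[OF x])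
qed

text \<open>
  The curvature component with two entries \<open>\<partial>\<^sub>s\<close>. For \<open>\<phi> = e\<^sup>f\<close> the right hand side is \<open>- \<phi> D\<^sup>2\<phi>\<close>,
  the classical formula for a warping function \<open>\<phi>\<close>.
\<close>

lemma riemann_warped_metric_mixed:
  assumes x: "x \<in> U"
  shows "warped_metric (x, s) (riemann warped_metric (x, s) (v, 0) (0, 1) (0, 1)) (w, 0)
     = - exp (2 * f x) * (hessian h f x v w + dir_deriv f x v * dir_deriv f x w)"
proof -
  let ?z = "gradient h f" and ?E = "exp (2 * f x)"
  note l = inner_form_linear[OF inner_form_h[OF x]]
  note c = christoffel_linear[OF x]
  have c0: "christoffel h y 0 b = 0" "christoffel h y b 0 = 0" if "y \<in> U" for y b
    using linear_0[OF christoffel_linear(1)[OF that]] linear_0[OF christoffel_linear(2)[OF that]] by auto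
  have "((\<lambda>y. - (exp (2 * f y) *\<^sub>R ?z y)) has_derivative
    (\<lambda>v. - (?E *\<^sub>R dir_deriv ?z x v + (2 * ?E * dir_deriv f x v) *\<^sub>R ?z x))) (at x)"
    by (auto intro!: derivative_eq_intros dir_deriv_works f_diff[OF x] gradient_diff[OF x])
  then have 1: "dir_deriv (\<lambda>y. christoffel warped_metric y (0, 1) (0, 1)) (x, s) (v, 0)
      = (- (?E *\<^sub>R dir_deriv ?z x v + (2 * ?E * dir_deriv f x v) *\<^sub>R ?z x), 0)"
    by (intro dir_deriv_product[OF x _ _ has_derivative_const])
      (simp_all add: christoffel_warped_metric c0 linear_0[OF df_linear])
  have 2: "dir_deriv (\<lambda>y. christoffel warped_metric y (v, 0) (0, 1)) (x, s) (0, 1) = (0, dir_deriv (\<lambda>y. dir_deriv f y v) x 0)"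
    by (rule dir_deriv_product[OF x _ has_derivative_const dir_deriv_works[OF df_diff[OF x]]])
      (simp add: christoffel_warped_metric c0)
  have "riemann warped_metric (x, s) (v, 0) (0, 1) (0, 1)
    = (- (?E *\<^sub>R (dir_deriv ?z x v + christoffel h x v (?z x) + dir_deriv f x v *\<^sub>R ?z x)), 0)"
    unfolding riemann_def 1 2
    by (simp add: christoffel_warped_metric[OF x] c0[OF x] linear_0[OF df_linear[OF x]] linear_0[OF dir_deriv_linear[OF df_diff[OF x]]]
      linear_neg[OF c(2)] linear_cmul[OF c(2)] algebra_simps flip: scaleR_2)
  then show ?thesis
    by (simp add: warped_metric_simp hessian_eq[OF x] linear_neg[OF l(2)] linear_cmul[OF l(2)] linear_add[OF l(2)] gradient_works[OF x])
qed

lemma riemann_norm_le_warped: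
  assumes x: "x \<in> U"
  shows "riemann_norm h x \<le> riemann_norm warped_metric (x, s)"
  using tensor4_norm_block_ge(1)[OF inner_form_h[OF x], of "exp (f x)"
    "\<lambda>a b c d. warped_metric (x, s) (riemann warped_metric (x, s) a b c) d", folded warped_metric_block[of x s]]
  by (simp add: riemann_norm_def riemann_warped_metric_base[OF x] warped_metric_simp)

text \<open>
  \<open>D\<^sup>2f + df \<otimes> df\<close>, which is \<open>e\<^sup>-\<^sup>f D\<^sup>2(e\<^sup>f)\<close>.
\<close>

definition mixed_tensor :: "(real^'n) local_form" where
  "mixed_tensor x v w = hessian h f x v w + dir_deriv f x v * dir_deriv f x w"

lemma mixed_tensor_linear:
  assumes x: "x \<in> U"
  shows "linear (\<lambda>v. mixed_tensor x v w)" "linear (mixed_tensor x v)"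
proof -
  note df = df_linear[OF x] and H = hessian_linear[OF x]
  show "linear (\<lambda>v. mixed_tensor x v w)" "linear (mixed_tensor x v)"
    unfolding mixed_tensor_def
    by (auto intro!: linearI simp: linear_add[OF df] linear_cmul[OF df]
        linear_add[OF H(1)] linear_cmul[OF H(1)] linear_add[OF H(2)] linear_cmul[OF H(2)] algebra_simps)
qed

lemma mixed_curvature_le_warped:
  assumes x: "x \<in> U"
  shows "tensor2_norm (h x) (mixed_tensor x) \<le> riemann_norm warped_metric (x, s)"
proof -
  have "tensor2_norm (h x) (\<lambda>a d. - exp (2 * f x) * mixed_tensor x a d) \<le> exp (2 * f x) * riemann_norm warped_metric (x, s)"
    using tensor4_norm_block_ge(2)[OF inner_form_h[OF x], of "exp (f x)"
      "\<lambda>a b c d. warped_metric (x, s) (riemann warped_metric (x, s) a b c) d", folded warped_metric_block[of x s]]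
    by (simp add: riemann_norm_def riemann_warped_metric_mixed[OF x] mixed_tensor_def exp_double)
  then show ?thesis unfolding tensor2_norm_cmul by simp
qed

text \<open>
  At a critical point of \<open>|\<nabla>f|\<^sup>2\<close> the Hessian drops out of \<open>S(\<nabla>f, \<nabla>f)\<close>, where \<open>S = D\<^sup>2f + df \<otimes> df\<close>,
  and leaves \<open>|\<nabla>f|\<^sup>4\<close>; the Cauchy--Schwarz inequality gives one factor \<open>|\<nabla>f|\<^sup>2\<close> back.
\<close>

lemma grad_sq_le_at_critical:
  assumes x: "x \<in> U" and crit: "\<And>v. dir_deriv grad_sq x v = 0"
  shows "grad_sq x \<le> tensor2_norm (h x) (mixed_tensor x)"
proof -
  let ?z = "gradient h f x"
  have "hessian h f x ?z ?z = 0"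
    using crit[of ?z] dir_deriv_eqI[OF grad_sq_has_derivative[OF x], of ?z] by simp
  then have "mixed_tensor x ?z ?z = grad_sq x ^ 2"
    by (simp add: mixed_tensor_def grad_sq_def gradient_works[OF x, symmetric] power2_eq_square)
  moreover have "mixed_tensor x ?z ?z \<le> tensor2_norm (h x) (mixed_tensor x) * grad_sq x"
    unfolding grad_sq_def
    by (rule order.trans[OF abs_ge_self
          tensor2_Cauchy_Schwarz[OF inner_form_h[OF x] mixed_tensor_linear[OF x]]])
  ultimately have "grad_sq x * grad_sq x \<le> tensor2_norm (h x) (mixed_tensor x) * grad_sq x"
    by (simp add: power2_eq_square)
  moreover have "tensor2_norm (h x) (mixed_tensor x) \<ge> 0" by (rule tensor2_norm_nonneg[OF inner_form_h[OF x]])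
  ultimately show ?thesis
    using grad_sq_nonneg[OF x] by (cases "grad_sq x = 0") (auto simp: mult_le_cancel_right)
qed

text \<open>
  Componentwise in a frame, \<open>D\<^sup>2f = S - df \<otimes> df\<close>, and \<open>|df \<otimes> df| = |\<nabla>f|\<^sup>2\<close>.
\<close>

lemma hessian_norm_le:
  assumes x: "x \<in> U"
  shows "(tensor2_norm (h x) (hessian h f x))\<^sup>2 \<le> 2 * (tensor2_norm (h x) (mixed_tensor x))\<^sup>2 + 2 * (grad_sq x)\<^sup>2"
proof -
  note I = inner_form_h[OF x]
  obtain E where E: "orthonormal_frame (h x) E" using orthonormal_frame_exists[OF I] by blast
  have "(hessian h f x k l)\<^sup>2 \<le> 2 * (mixed_tensor x k l)\<^sup>2 + 2 * ((dir_deriv f x k)\<^sup>2 * (dir_deriv f x l)\<^sup>2)" for k l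
  proof -
    have "(a - b)\<^sup>2 \<le> 2 * a\<^sup>2 + 2 * b\<^sup>2" for a b :: real
      using zero_le_power2[of "a + b"] by (simp add: power2_eq_square algebra_simps)
    from this[of "mixed_tensor x k l" "dir_deriv f x k * dir_deriv f x l"] show ?thesis
      by (simp add: mixed_tensor_def power_mult_distrib)
  qed
  then have "(\<Sum>k\<in>E. \<Sum>l\<in>E. (hessian h f x k l)\<^sup>2)
     \<le> (\<Sum>k\<in>E. \<Sum>l\<in>E. 2 * (mixed_tensor x k l)\<^sup>2 + 2 * ((dir_deriv f x k)\<^sup>2 * (dir_deriv f x l)\<^sup>2))"
    by (intro sum_mono)
  also have "\<dots> = 2 * (\<Sum>k\<in>E. \<Sum>l\<in>E. (mixed_tensor x k l)\<^sup>2) + 2 * (\<Sum>k\<in>E. (dir_deriv f x k)\<^sup>2)\<^sup>2"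
    by (simp add: sum.distrib sum_distrib_left[symmetric] power2_eq_square[of "sum _ _"] sum_product)
  also have "(\<Sum>k\<in>E. (dir_deriv f x k)\<^sup>2) = grad_sq x"
    unfolding grad_sq_def parseval[OF I E, of "gradient h f x" "gradient h f x"]
    by (simp add: gradient_works[OF x] power2_eq_square)
  finally show ?thesis
    by (simp only: tensor2_norm_frame_linear[OF I E hessian_linear[OF x]]
        tensor2_norm_frame_linear[OF I E mixed_tensor_linear[OF x]])
qed

end

section \<open>Maxima on a compact manifold and the gradient bound\<close>

lemma smooth_manifold_chart:
  assumes "smooth_manifold N A"
  shows "openin N (fst (A i))" "open (chart_image (A i))"
    "homeomorphic_map (subtopology N (fst (A i))) (top_of_set (chart_image (A i))) (snd (A i))"
    "inj_on (snd (A i)) (fst (A i))" "topspace (subtopology N (fst (A i))) = fst (A i)"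
    "(\<Union>i. fst (A i)) = topspace N" "smooth_on (transition A i j) (overlap A i j)"
proof -
  show o: "openin N (fst (A i))"
    and h: "homeomorphic_map (subtopology N (fst (A i))) (top_of_set (chart_image (A i))) (snd (A i))"
    and "open (chart_image (A i))" "(\<Union>i. fst (A i)) = topspace N"
    "smooth_on (transition A i j) (overlap A i j)"
    using assms by (auto simp: smooth_manifold_def)
  show t: "topspace (subtopology N (fst (A i))) = fst (A i)"
    using openin_subset[OF o] by auto
  show "inj_on (snd (A i)) (fst (A i))"
    using homeomorphic_imp_injective_map[OF h] unfolding t .
qed

lemma chart_inv_chart:
  assumes "smooth_manifold N A" "p \<in> fst (A i)"
  shows "chart_inv (A i) (snd (A i) p) = p"
  unfolding chart_inv_def using inv_into_f_f[OF smooth_manifold_chart(4)[OF assms(1)] assms(2)] .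

lemma open_overlap:
  assumes M: "smooth_manifold N A"
  shows "open (overlap A i j)"
proof -
  note c = smooth_manifold_chart[OF M]
  have "openin (subtopology N (fst (A i))) (fst (A i) \<inter> fst (A j))"
    using c(1)[of j] by (simp add: openin_subtopology_Int2 Int_commute)
  then have "openin (top_of_set (chart_image (A i))) (overlap A i j)"
    unfolding overlap_def
    using homeomorphic_map_openness[OF c(3)[of i], of "fst (A i) \<inter> fst (A j)"] c(5)[of i] by auto
  then show ?thesis using c(2)[of i] openin_open_trans by blast
qed

lemma transition_differentiable:
  assumes M: "smooth_manifold N A" and "x \<in> overlap A i j"
  shows "transition A i j differentiable (at x)"
proof -
  have "Ck_on (Suc 0) (transition A i j) (overlap A i j)"
    using smooth_manifold_chart(7)[OF M] by (simp only: smooth_on_def)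
  then show ?thesis
    using assms(2) open_overlap[OF M] by (simp add: differentiable_on_eq_differentiable_at)
qed

text \<open>
  Compatible continuous functions in the charts glue to a continuous function on the manifold.
\<close>

lemma compact_manifold_attains_sup:
  fixes A :: "('i, 'a, 'e::euclidean_space) atlas" and F :: "'i \<Rightarrow> 'e \<Rightarrow> real"
  assumes M: "smooth_manifold N A" and N: "compact_space N" "topspace N \<noteq> {}"
    and cont: "\<And>i. continuous_on (chart_image (A i)) (F i)"
    and consistent: "\<And>i j p. p \<in> fst (A i) \<Longrightarrow> p \<in> fst (A j) \<Longrightarrow> F i (snd (A i) p) = F j (snd (A j) p)"
  shows "\<exists>i. \<exists>x\<in>chart_image (A i). \<forall>j. \<forall>y\<in>chart_image (A j). F j y \<le> F i x"
proof -
  note c = smooth_manifold_chart[OF M]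
  \<comment> \<open>Any chart around \<open>p\<close> gives the same value, by consistency.\<close>
  define g where "g p = (let i = SOME i. p \<in> fst (A i) in F i (snd (A i) p))" for p
  have g: "g p = F i (snd (A i) p)" if "p \<in> fst (A i)" for p i
    unfolding g_def Let_def using someI[of "\<lambda>i. p \<in> fst (A i)", OF that] that by (rule consistent)
  have "continuous_map N euclideanreal g"
  proof (rule pasting_lemma[where I = UNIV and T = "\<lambda>i. fst (A i)" and f = "\<lambda>i p. F i (snd (A i) p)"])
    show "openin N (fst (A i))" for i by (rule c(1))
    show "continuous_map (subtopology N (fst (A i))) euclideanreal (\<lambda>p. F i (snd (A i) p))" for i
      using continuous_map_compose[OF homeomorphic_imp_continuous_map[OF c(3)[of i]], of euclideanreal "F i"] cont[of i]
      by (simp add: o_def)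
    show "F i (snd (A i) p) = F j (snd (A j) p)"
      if "p \<in> topspace N \<inter> fst (A i) \<inter> fst (A j)" for i j p
      using that by (intro consistent) auto
    show "\<exists>j. j \<in> UNIV \<and> p \<in> fst (A j) \<and> g p = F j (snd (A j) p)" if "p \<in> topspace N" for p
      using that g unfolding c(6)[symmetric] by blast
  qed
  then have "compact (g ` topspace N)"
    using image_compactin[of N "topspace N" euclideanreal g] N(1) by (simp add: compact_space_def)
  moreover have "g ` topspace N \<noteq> {}" using N(2) by simp
  ultimately obtain p where p: "p \<in> topspace N" and max: "\<And>q. q \<in> topspace N \<Longrightarrow> g q \<le> g p"
    using compact_attains_sup[of "g ` topspace N"] by auto
  obtain i where i: "p \<in> fst (A i)" using p unfolding c(6)[symmetric] by blast
  have "F j y \<le> F i (snd (A i) p)" if y: "y \<in> chart_image (A j)" for j y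
  proof -
    obtain q where q: "q \<in> fst (A j)" "y = snd (A j) q" using y by (auto simp: chart_image_def)
    moreover have "q \<in> topspace N" using q(1) unfolding c(6)[symmetric] by blast
    ultimately show ?thesis using max[of q] g[OF i] g[OF q(1)] by simp
  qed
  moreover have "snd (A i) p \<in> chart_image (A i)" using i by (simp add: chart_image_def)
  ultimately show ?thesis by blast
qed

abbreviation local_function :: "('i, 'a, 'e) atlas \<Rightarrow> ('a \<Rightarrow> real) \<Rightarrow> 'i \<Rightarrow> 'e \<Rightarrow> real" where
  "local_function A f i \<equiv> \<lambda>y. f (chart_inv (A i) y)"

locale warped_manifold =
  fixes N :: "'a topology" and A :: "('i, 'a, real^'n) atlas"
    and h :: "('i, real^'n) form_field" and f :: "'a \<Rightarrow> real"
  assumes manifold: "smooth_manifold N A"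
    and inner: "x \<in> chart_image (A i) \<Longrightarrow> inner_form (h i x)"
    and metric_C2: "Ck_on 2 (\<lambda>x. h i x v w) (chart_image (A i))"
    and tensor: "x \<in> overlap A i j \<Longrightarrow> h i x v w =
          h j (transition A i j x) (dir_deriv (transition A i j) x v) (dir_deriv (transition A i j) x w)"
    and function_C2: "Ck_on 2 (local_function A f i) (chart_image (A i))"
begin

lemma warped_chart: "warped_chart (chart_image (A i)) (h i) (local_function A f i)"
  by unfold_locales (use smooth_manifold_chart(2)[OF manifold] inner metric_C2 function_C2 in auto)

abbreviation grad_sq where "grad_sq i \<equiv> warped_chart.grad_sq (h i) (local_function A f i)"

text \<open>
  \<open>|\<nabla>f|\<^sup>2\<close> is the largest value of \<open>df(v)\<^sup>2 / |v|\<^sup>2\<close>, and a change of charts preserves \<open>df(v)\<close> and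
  \<open>|v|\<close>. Pushing the gradient of one chart into the other gives an inequality; exchanging the charts gives
  the reverse one.
\<close>

lemma grad_sq_le_other_chart:
  assumes p: "p \<in> fst (A i)" "p \<in> fst (A j)"
  shows "grad_sq i (snd (A i) p) \<le> grad_sq j (snd (A j) p)"
proof -
  interpret Ci: warped_chart "chart_image (A i)" "h i" "local_function A f i" by (rule warped_chart)
  interpret Cj: warped_chart "chart_image (A j)" "h j" "local_function A f j" by (rule warped_chart)
  let ?\<tau> = "transition A i j"
  define x where "x = snd (A i) p"
  have tau: "?\<tau> (snd (A i) q) = snd (A j) q" if "q \<in> fst (A i)" for q
    by (simp add: transition_def chart_inv_chart[of N A, OF manifold that])
  have x: "x \<in> overlap A i j" "x \<in> chart_image (A i)" and y: "?\<tau> x \<in> chart_image (A j)"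
    using p tau[OF p(1)] by (auto simp: x_def overlap_def chart_image_def)
  have "((local_function A f j \<circ> ?\<tau>) has_derivative
      dir_deriv (local_function A f j) (?\<tau> x) \<circ> dir_deriv ?\<tau> x) (at x)"
    by (rule diff_chain_at[OF dir_deriv_works[OF transition_differentiable[OF manifold x(1)]]
          dir_deriv_works[OF Cj.f_diff[OF y]]])
  then have "(local_function A f i has_derivative
      dir_deriv (local_function A f j) (?\<tau> x) \<circ> dir_deriv ?\<tau> x) (at x)"
  proof (rule has_derivative_transform_within_open[OF _ open_overlap[OF manifold] x(1)])
    fix y assume "y \<in> overlap A i j"
    then obtain q where q: "q \<in> fst (A i)" "q \<in> fst (A j)" "y = snd (A i) q"
      by (auto simp: overlap_def)
    then show "(local_function A f j \<circ> ?\<tau>) y = local_function A f i y"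
      by (simp add: tau chart_inv_chart[of N A, OF manifold])
  qed
  then have df: "dir_deriv (local_function A f i) x v
      = dir_deriv (local_function A f j) (?\<tau> x) (dir_deriv ?\<tau> x v)" for v
    by (simp add: dir_deriv_eqI)
  let ?z = "gradient (h i) (local_function A f i) x"
  let ?z' = "gradient (h j) (local_function A f j) (?\<tau> x)"
  let ?w = "dir_deriv ?\<tau> x ?z"
  have "grad_sq i x = h j (?\<tau> x) ?z' ?w"
    unfolding Ci.grad_sq_def Ci.gradient_works[OF x(2)] Cj.gradient_works[OF y] df ..
  then have "(grad_sq i x)\<^sup>2 \<le> h j (?\<tau> x) ?z' ?z' * h j (?\<tau> x) ?w ?w"
    using inner_form_Cauchy_Schwarz[OF inner[OF y]] by simp
  also have "\<dots> = grad_sq j (?\<tau> x) * grad_sq i x"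
    unfolding Ci.grad_sq_def Cj.grad_sq_def by (simp only: tensor[OF x(1)])
  finally have "grad_sq i x * grad_sq i x \<le> grad_sq j (?\<tau> x) * grad_sq i x"
    by (simp add: power2_eq_square)
  then have "grad_sq i x \<le> grad_sq j (?\<tau> x)"
    using Ci.grad_sq_nonneg[OF x(2)] Cj.grad_sq_nonneg[OF y]
    by (cases "grad_sq i x = 0") (auto simp: mult_le_cancel_right)
  then show ?thesis by (simp add: x_def tau[OF p(1)])
qed

lemma grad_sq_le_mixed_curvature:
  assumes N: "compact_space N" and x: "x \<in> chart_image (A i)"
    and bound: "\<And>j y. y \<in> chart_image (A j) \<Longrightarrow>
       tensor2_norm (h j y) (warped_chart.mixed_tensor (h j) (local_function A f j) y) \<le> b"
  shows "grad_sq i x \<le> b"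
proof -
  have ne: "topspace N \<noteq> {}"
    using x smooth_manifold_chart(6)[OF manifold] by (auto simp: chart_image_def)
  have cont: "continuous_on (chart_image (A j)) (grad_sq j)" for j
    using warped_chart.grad_sq_has_derivative[OF warped_chart]
    by (meson continuous_at_imp_continuous_on has_derivative_continuous)
  have cons: "grad_sq j (snd (A j) p) = grad_sq k (snd (A k) p)" if "p \<in> fst (A j)" "p \<in> fst (A k)" for j k p
    using grad_sq_le_other_chart that by (meson order_antisym)
  obtain j y where y: "y \<in> chart_image (A j)"
    and max: "\<And>k z. z \<in> chart_image (A k) \<Longrightarrow> grad_sq k z \<le> grad_sq j y"
    using compact_manifold_attains_sup[OF manifold N ne cont cons] by blast
  interpret C: warped_chart "chart_image (A j)" "h j" "local_function A f j" by (rule warped_chart)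
  have "dir_deriv C.grad_sq y = (\<lambda>v. 0)"
    by (rule differential_zero_maxmin[OF y C.open_U dir_deriv_works[OF differentiableI[OF C.grad_sq_has_derivative[OF y]]]])
      (use max in auto)
  then have "C.grad_sq y \<le> b"
    using C.grad_sq_le_at_critical[OF y] bound[OF y] by simp
  then show ?thesis using max[OF x] by simp
qed

text \<open>
  The bounds at a fixed time in terms of a bound \<open>b\<close> for the curvature of the warped product. It is
  enough to know that bound on the slice \<open>s = 0\<close>, because translations in \<open>s\<close> are isometries.
\<close>

lemma warped_bounds:
  assumes N: "compact_space N" and x: "x \<in> chart_image (A i)"
    and bound: "\<And>j y. y \<in> chart_image (A j) \<Longrightarrow> riemann_norm (warped_product_metric A h f j) (y, 0) \<le> b"
  shows "riemann_norm (h i) x \<le> b" "(tensor2_norm (h i x) (hessian (h i) (local_function A f i) x))\<^sup>2 \<le> 4 * b\<^sup>2"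
    "(vector_norm (h i x) (gradient (h i) (local_function A f i) x))\<^sup>2 \<le> b"
proof -
  interpret C: warped_chart "chart_image (A i)" "h i" "local_function A f i" by (rule warped_chart)
  have G: "warped_product_metric A h f j = warped_chart.warped_metric (h j) (local_function A f j)" for j
    by (simp add: warped_product_metric_def warped_chart.warped_metric_def[OF warped_chart])
  have S: "tensor2_norm (h j y) (warped_chart.mixed_tensor (h j) (local_function A f j) y) \<le> b"
    if "y \<in> chart_image (A j)" for j y
    using warped_chart.mixed_curvature_le_warped[OF warped_chart that] bound[OF that]
    unfolding G by (rule order_trans)
  have e: "C.grad_sq x \<le> b"
    using grad_sq_le_mixed_curvature[OF N x S] .
  show "riemann_norm (h i) x \<le> b"
    using C.riemann_norm_le_warped[OF x] bound[OF x] unfolding G by (rule order_trans)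
  show "(vector_norm (h i x) (gradient (h i) (local_function A f i) x))\<^sup>2 \<le> b"
    using e C.grad_sq_nonneg[OF x] by (simp add: vector_norm_def C.grad_sq_def)
  have "(tensor2_norm (h i x) (C.mixed_tensor x))\<^sup>2 \<le> b\<^sup>2" "(C.grad_sq x)\<^sup>2 \<le> b\<^sup>2"
    using S[OF x] e tensor2_norm_nonneg[OF inner[OF x]] C.grad_sq_nonneg[OF x] by (simp_all add: power_mono)
  then show "(tensor2_norm (h i x) (hessian (h i) (local_function A f i) x))\<^sup>2 \<le> 4 * b\<^sup>2"
    using C.hessian_norm_le[OF x] by linarith
qed

end

lemma warped_manifold_slice:
  fixes A :: "('i, 'a, real^'n) atlas"
  assumes "smooth_manifold N A" "smooth_time_function A T u" "smooth_metric_family A T h"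
    and "open T" "t \<in> T"
  shows "warped_manifold N A (h t) (\<lambda>p. u p t)"
proof
  fix i j x v w
  have op: "open (chart_image (A i))" by (rule smooth_manifold_chart(2)[OF assms(1)])
  show "smooth_manifold N A" by fact
  show "Ck_on 2 (\<lambda>x. h t i x v w) (chart_image (A i))"
    using Ck_on_slice[OF op assms(4,5), of 2 "\<lambda>(x, t). h t i x v w"] assms(3)
    by (simp add: smooth_metric_family_def smooth_on_def)
  show "Ck_on 2 (\<lambda>x. u (chart_inv (A i) x) t) (chart_image (A i))"
    using Ck_on_slice[OF op assms(4,5), of 2 "\<lambda>(x, t). u (chart_inv (A i) x) t"] assms(2)
    by (simp add: smooth_time_function_def smooth_on_def)
  show "inner_form (h t i x)" if "x \<in> chart_image (A i)"
    using assms(3,5) that by (simp add: smooth_metric_family_def)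
  show "h t i x v w = h t j (transition A i j x) (dir_deriv (transition A i j) x v) (dir_deriv (transition A i j) x w)"
    if "x \<in> overlap A i j"
    using assms(3,5) that unfolding smooth_metric_family_def by blast
qed

text \<open>
  With \<open>b = K / t\<close> in \<open>warped_bounds\<close>, the three terms times \<open>t\<close> are at most \<open>K\<close>, \<open>4 K\<^sup>2 / t\<close> and \<open>K\<close>.
\<close>

theorem theorem2:
  fixes N :: "'a topology"
    and A :: "('i, 'a, real^3) atlas"
    and u :: "'a \<Rightarrow> real \<Rightarrow> real"
    and h :: "real \<Rightarrow> ('i, real^3) form_field"
    and \<alpha> :: real
  assumes "smooth_manifold N A"
    and "compact_space N"
    and "smooth_time_function A {0<..} u"
    and "smooth_metric_family A {0<..} h"
    and "\<And>t. t > 0 \<Longrightarrow> positive_scalar_curvature (product_line_atlas A)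
                          (warped_product_metric A (h t) (\<lambda>p. u p t))"
    and "type_III_ricci_flow (product_line_atlas A)
           (\<lambda>t. warped_product_metric A (h t) (\<lambda>p. u p t))"
    and "\<alpha> > 0"
  shows "\<exists>C>0. \<forall>t>\<alpha>. \<forall>i. \<forall>x\<in>chart_image (A i).
           (let ut = (\<lambda>y. u (chart_inv (A i) y) t); ht = h t i in
            t * (riemann_norm ht x
                 + (tensor2_norm (ht x) (hessian ht ut x))\<^sup>2
                 + (vector_norm (ht x) (gradient ht ut x))\<^sup>2) \<le> C)"
proof -
  obtain K where K: "\<And>t i x. t > 0 \<Longrightarrow> x \<in> chart_image (product_line_atlas A i) \<Longrightarrow>
      t * riemann_norm (warped_product_metric A (h t) (\<lambda>p. u p t) i) x \<le> K"
    using assms(6) unfolding type_III_ricci_flow_def bdd_above_def by blast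
  \<comment> \<open>The summand 1 only ensures positivity.\<close>
  define C where "C = 2 * \<bar>K\<bar> + 4 * K\<^sup>2 / \<alpha> + 1"
  have "C > 0" using \<open>\<alpha> > 0\<close> by (simp add: C_def add_nonneg_pos)
  moreover have "t * (riemann_norm (h t i) x
        + (tensor2_norm (h t i x) (hessian (h t i) (\<lambda>y. u (chart_inv (A i) y) t) x))\<^sup>2
        + (vector_norm (h t i x) (gradient (h t i) (\<lambda>y. u (chart_inv (A i) y) t) x))\<^sup>2) \<le> C"
    if t: "t > \<alpha>" and x: "x \<in> chart_image (A i)" for t i x
  proof -
    have t0: "t > 0" using t \<open>\<alpha> > 0\<close> by simp
    interpret warped_manifold N A "h t" "\<lambda>p. u p t"
      by (rule warped_manifold_slice[OF assms(1,3,4)]) (use t0 in auto)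
    have "riemann_norm (warped_product_metric A (h t) (\<lambda>p. u p t) j) (y, 0) \<le> K / t"
      if "y \<in> chart_image (A j)" for j y
    proof -
      have "(y, 0) \<in> chart_image (product_line_atlas A j)"
        using that by (force simp: chart_image_def product_line_atlas_def)
      then show ?thesis using K[OF t0] t0 by (simp add: field_simps)
    qed
    note b = warped_bounds[OF assms(2) x this]
    have "t * (riemann_norm (h t i) x
        + (tensor2_norm (h t i x) (hessian (h t i) (\<lambda>y. u (chart_inv (A i) y) t) x))\<^sup>2
        + (vector_norm (h t i x) (gradient (h t i) (\<lambda>y. u (chart_inv (A i) y) t) x))\<^sup>2)
      \<le> t * (K / t + 4 * (K / t)\<^sup>2 + K / t)"
      using b t0 by (intro mult_left_mono add_mono) auto
    also have "\<dots> = 2 * K + 4 * K\<^sup>2 / t"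
      using t0 by (simp add: field_simps power2_eq_square)
    also have "\<dots> \<le> C"
    proof -
      have "4 * K\<^sup>2 / t \<le> 4 * K\<^sup>2 / \<alpha>"
        using t \<open>\<alpha> > 0\<close> by (intro divide_left_mono) auto
      then show ?thesis unfolding C_def by linarith
    qed
    finally show ?thesis .
  qed
  ultimately show ?thesis unfolding Let_def by blast
qed

end
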